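(* Let $(M,F)$ be a Landsberg surface (a Finsler surface with $\mathcal{J}=0$) with nonflat geodesic spray $S$, and let $(H,S,V,\mathcal{C})$ be its Berwald frame. If $V(\rho)=-\mathcal{I}$, then $(M,F)$ is Riemannian.
   Context: $M$ is a $2$-dimensional smooth manifold, $\mathcal{T}M$ its tangent bundle with the zero section removed, with induced coordinates $(x^i,y^i)$; $J=\frac{\partial}{\partial y^i}\otimes dx^i$ is the almost-tangent structure and $\mathcal{C}=y^i\frac{\partial}{\partial y^i}$ the Liouville vector field. $F:TM\to\mathbb{R}$ is a Finsler function: smooth and positive on $\mathcal{T}M$, zero exactly on the zero section, positively $1$-homogeneous in $y$, with $g_{ij}=\frac12\frac{\partial^2F^2}{\partial y^i\partial y^j}$ of maximal rank on $\mathcal{T}M$. $S=y^i\frac{\partial}{\partial x^i}-2G^i\frac{\partial}{\partial y^i}$ is its geodesic spray, and "horizontal" refers to the image of the projector $h=\frac12(Id+[J,S])$ (Frölicher–Nijenhuis bracket). With $G^i_j=\partial G^i/\partial y^j$, the Jacobi endomorphism is $\Phi=\big(2\frac{\partial G^i}{\partial x^j}-S(G^i_j)-G^i_kG^k_j\big)\frac{\partial}{\partial y^i}\otimes dx^j$; in dimension $2$ one has $\Phi=K(F^2J-F\,d_JF\otimes\mathcal{C})$, where $K\in C^\infty(\mathcal{T}M)$ is the flag curvature; the Ricci scalar is $\rho=KF^2$. $S$ is nonflat: $K$ vanishes nowhere on $\mathcal{T}M$. Berwald frame: $H$ is a horizontal vector field on $\mathcal{T}M$ with $[\mathcal{C},H]=H$,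 $d_JF(H)=0$, $V:=JH$, normalized so that $[S,H]=\rho V$, $[V,S]=H$, $[H,V]=S+\mathcal{I}H+\mathcal{J}V$ with $\mathcal{J}=S(\mathcal{I})$. Here $\mathcal{I}$ is the main (Cartan) scalar and $\mathcal{J}$ the Landsberg scalar. $H,S,V$ annihilate $F$. $(M,F)$ is Riemannian when $F^2$ is a quadratic form in $y$, equivalently $\mathcal{I}=0$; it is Landsbergian when $\mathcal{J}=0$. *)

theory Defs
  imports "HOL-Analysis.Analysis"
begin

section \<open>Smooth maps, smooth manifolds, vector fields\<close>

primrec Ck_on :: "nat \<Rightarrow> 'a::real_normed_vector set \<Rightarrow> ('a \<Rightarrow> 'b::real_normed_vector) \<Rightarrow> bool" where
  "Ck_on 0 U f \<longleftrightarrow> continuous_on U f"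
| "Ck_on (Suc k) U f \<longleftrightarrow>
     (\<forall>x\<in>U. f differentiable (at x)) \<and> (\<forall>v. Ck_on k U (\<lambda>x. frechet_derivative f (at x) v))"

definition smooth_on :: "'a::real_normed_vector set \<Rightarrow> ('a \<Rightarrow> 'b::real_normed_vector) \<Rightarrow> bool" where
  "smooth_on U f \<longleftrightarrow> (\<forall>k. Ck_on k U f)"

text \<open>A chart is a domain together with a coordinate map; only the values of the coordinate map
  on the domain matter.\<close>

type_synonym ('p, 'e) chart = "'p set \<times> ('p \<Rightarrow> 'e)"

definition dom :: "('p, 'e) chart \<Rightarrow> 'p set" where
  "dom c = fst c"

definition coord :: "('p, 'e) chart \<Rightarrow> 'p \<Rightarrow> 'e" where
  "coord c = snd c"

definition param :: "('p, 'e) chart \<Rightarrow> 'e \<Rightarrow> 'p" where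
  "param c = inv_into (dom c) (coord c)"

definition smooth_manifold :: "'p topology \<Rightarrow> ('p, 'e::euclidean_space) chart set \<Rightarrow> bool" where
  "smooth_manifold T A \<longleftrightarrow>
     Hausdorff_space T \<and> second_countable T \<and>
     (\<Union>c\<in>A. dom c) = topspace T \<and>
     (\<forall>c\<in>A. openin T (dom c) \<and> open (coord c ` dom c) \<and>
        homeomorphic_map (subtopology T (dom c)) (top_of_set (coord c ` dom c)) (coord c)) \<and>
     (\<forall>c\<in>A. \<forall>d\<in>A. smooth_on (coord c ` (dom c \<inter> dom d)) (coord d \<circ> param c))"

text \<open>A tangent vector at \<open>p\<close> is the family of its component vectors in all charts around \<open>p\<close>,
  subject to the contravariant transformation law.  Components in the charts that do not contain
  \<open>p\<close> are set to zero, so that a tangent vector is determined by its components.\<close>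

definition tangent_vector ::
    "('p, 'e::euclidean_space) chart set \<Rightarrow> 'p \<Rightarrow> (('p, 'e) chart \<Rightarrow> 'e) \<Rightarrow> bool" where
  "tangent_vector A p \<xi> \<longleftrightarrow>
     (\<forall>c\<in>A. \<forall>d\<in>A. p \<in> dom c \<longrightarrow> p \<in> dom d \<longrightarrow>
        \<xi> d = frechet_derivative (coord d \<circ> param c) (at (coord c p)) (\<xi> c)) \<and>
     (\<forall>c. \<not> (c \<in> A \<and> p \<in> dom c) \<longrightarrow> \<xi> c = 0)"

definition smooth_function :: "('p, 'e::euclidean_space) chart set \<Rightarrow> ('p \<Rightarrow> real) \<Rightarrow> bool" where
  "smooth_function A f \<longleftrightarrow> (\<forall>c\<in>A. smooth_on (coord c ` dom c) (f \<circ> param c))"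

type_synonym ('p, 'e) vfield = "'p \<Rightarrow> ('p, 'e) chart \<Rightarrow> 'e"

definition smooth_vfield ::
    "('p, 'e::euclidean_space) chart set \<Rightarrow> ('p, 'e) vfield \<Rightarrow> bool" where
  "smooth_vfield A X \<longleftrightarrow>
     (\<forall>p\<in>(\<Union>c\<in>A. dom c). tangent_vector A p (X p)) \<and>
     (\<forall>c\<in>A. smooth_on (coord c ` dom c) (\<lambda>z. X (param c z) c))"

text \<open>The constructions of vector fields below are given by their component formula in every chart;
  components in charts that do not contain the base point are never used, whence this equality.\<close>

definition vf_eq ::
    "('p, 'e::euclidean_space) chart set \<Rightarrow> ('p, 'e) vfield \<Rightarrow> ('p, 'e) vfield \<Rightarrow> bool" where
  "vf_eq A X Y \<longleftrightarrow> (\<forall>c\<in>A. \<forall>p\<in>dom c. X p c = Y p c)"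

text \<open>\<open>deriv_eq A X f g\<close> means \<open>X(f) = g\<close>, evaluated in every chart.\<close>

definition deriv_eq ::
    "('p, 'e::euclidean_space) chart set \<Rightarrow> ('p, 'e) vfield \<Rightarrow> ('p \<Rightarrow> real) \<Rightarrow> ('p \<Rightarrow> real) \<Rightarrow> bool" where
  "deriv_eq A X f g \<longleftrightarrow>
     (\<forall>c\<in>A. \<forall>p\<in>dom c. frechet_derivative (f \<circ> param c) (at (coord c p)) (X p c) = g p)"

definition lie_bracket ::
    "('p, 'e::euclidean_space) vfield \<Rightarrow> ('p, 'e) vfield \<Rightarrow> ('p, 'e) vfield" where
  "lie_bracket X Y = (\<lambda>p c.
     frechet_derivative (\<lambda>z. Y (param c z) c) (at (coord c p)) (X p c) -
     frechet_derivative (\<lambda>z. X (param c z) c) (at (coord c p)) (Y p c))"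

section \<open>The slit tangent bundle of a surface\<close>

type_synonym 'm tpoint = "'m \<times> (('m, real^2) chart \<Rightarrow> real^2)"
type_synonym 'm tfield = "('m tpoint, (real^2) \<times> (real^2)) vfield"

definition slit_chart ::
    "('m, real^2) chart set \<Rightarrow> ('m, real^2) chart \<Rightarrow> ('m tpoint, (real^2) \<times> (real^2)) chart" where
  "slit_chart A c =
     ({(p, \<xi>). p \<in> dom c \<and> tangent_vector A p \<xi> \<and> \<xi> \<noteq> (\<lambda>_. 0)}, \<lambda>(p, \<xi>). (coord c p, \<xi> c))"

text \<open>The induced charts \<open>(x\<^sup>i, y\<^sup>i)\<close>.\<close>

definition slit_atlas ::
    "('m, real^2) chart set \<Rightarrow> ('m tpoint, (real^2) \<times> (real^2)) chart set" where
  "slit_atlas A = slit_chart A ` A"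

definition slit_bundle :: "('m, real^2) chart set \<Rightarrow> 'm tpoint set" where
  "slit_bundle A = (\<Union>u\<in>slit_atlas A. dom u)"

definition tangent_structure :: "'m tfield \<Rightarrow> 'm tfield" where
  "tangent_structure X = (\<lambda>u c. (0, fst (X u c)))"

definition liouville :: "'m tfield" where
  "liouville = (\<lambda>u c. (0, snd (coord c u)))"

section \<open>Finsler surfaces\<close>

definition dx :: "2 \<Rightarrow> ((real^2) \<times> (real^2) \<Rightarrow> real) \<Rightarrow> (real^2) \<times> (real^2) \<Rightarrow> real" where
  "dx i f z = frechet_derivative f (at z) (axis i 1, 0)"

definition dy :: "2 \<Rightarrow> ((real^2) \<times> (real^2) \<Rightarrow> real) \<Rightarrow> (real^2) \<times> (real^2) \<Rightarrow> real" where
  "dy i f z = frechet_derivative f (at z) (0, axis i 1)"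

text \<open>In the following local expressions, \<open>L\<close> is the Finsler function written in coordinates
  \<open>z = (x, y)\<close>.\<close>

definition metric :: "((real^2) \<times> (real^2) \<Rightarrow> real) \<Rightarrow> (real^2) \<times> (real^2) \<Rightarrow> real^2^2" where
  "metric L z = (\<chi> i j. 1/2 * dy i (dy j (\<lambda>w. (L w)\<^sup>2)) z)"

text \<open>The equation \<open>i\<^sub>S d d\<^sub>J F\<^sup>2 = - d F\<^sup>2\<close> of the geodesic spray reads
  \<open>S (\<partial>F\<^sup>2/\<partial>y\<^sup>j) = \<partial>F\<^sup>2/\<partial>x\<^sup>j\<close> in coordinates; solving it for \<open>G\<^sup>i\<close> gives
  \<open>G\<^sup>i = 1/4 g\<^sup>i\<^sup>j (y\<^sup>k \<partial>\<^sup>2F\<^sup>2/\<partial>x\<^sup>k\<partial>y\<^sup>j - \<partial>F\<^sup>2/\<partial>x\<^sup>j)\<close>.\<close>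

definition spray_coeff ::
    "((real^2) \<times> (real^2) \<Rightarrow> real) \<Rightarrow> 2 \<Rightarrow> (real^2) \<times> (real^2) \<Rightarrow> real" where
  "spray_coeff L i z =
     1/4 * (\<Sum>j\<in>UNIV. matrix_inv (metric L z) $ i $ j *
        ((\<Sum>k\<in>UNIV. snd z $ k * dx k (dy j (\<lambda>w. (L w)\<^sup>2)) z) - dx j (\<lambda>w. (L w)\<^sup>2) z))"

definition local_spray ::
    "((real^2) \<times> (real^2) \<Rightarrow> real) \<Rightarrow> (real^2) \<times> (real^2) \<Rightarrow> (real^2) \<times> (real^2)" where
  "local_spray L z = (snd z, \<chi> i. - 2 * spray_coeff L i z)"

definition jacobi_endo ::
    "((real^2) \<times> (real^2) \<Rightarrow> real) \<Rightarrow> 2 \<Rightarrow> 2 \<Rightarrow> (real^2) \<times> (real^2) \<Rightarrow> real" where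
  "jacobi_endo L i j z =
     2 * dx j (spray_coeff L i) z
     - frechet_derivative (dy j (spray_coeff L i)) (at z) (local_spray L z)
     - (\<Sum>k\<in>UNIV. dy k (spray_coeff L i) z * dy j (spray_coeff L k) z)"

text \<open>Positive definiteness of \<open>g\<close> is deliberately not required, only maximal rank.\<close>

definition finsler_function ::
    "('m, real^2) chart set \<Rightarrow> ('m tpoint \<Rightarrow> real) \<Rightarrow> bool" where
  "finsler_function A F \<longleftrightarrow>
     smooth_function (slit_atlas A) F \<and>
     (\<forall>u\<in>slit_bundle A. F u > 0) \<and>
     (\<forall>p\<in>(\<Union>c\<in>A. dom c). F (p, \<lambda>_. 0) = 0) \<and>
     (\<forall>p\<in>(\<Union>c\<in>A. dom c). \<forall>\<xi>. tangent_vector A p \<xi> \<longrightarrow>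
        (\<forall>t>0. F (p, \<lambda>c. t *\<^sub>R \<xi> c) = t * F (p, \<xi>))) \<and>
     (\<forall>c\<in>slit_atlas A. \<forall>u\<in>dom c. rank (metric (F \<circ> param c) (coord c u)) = 2)"

definition geodesic_spray :: "('m tpoint \<Rightarrow> real) \<Rightarrow> 'm tfield" where
  "geodesic_spray F = (\<lambda>u c. local_spray (F \<circ> param c) (coord c u))"

text \<open>\<open>K\<close> is characterised by \<open>\<Phi> = K (F\<^sup>2 J - F d\<^sub>JF \<otimes> \<C>)\<close>; taking
  traces shows that \<open>K\<close> is unique on the slit tangent bundle.\<close>

definition flag_curvature ::
    "('m, real^2) chart set \<Rightarrow> ('m tpoint \<Rightarrow> real) \<Rightarrow> ('m tpoint \<Rightarrow> real) \<Rightarrow> bool" where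
  "flag_curvature A F K \<longleftrightarrow>
     smooth_function (slit_atlas A) K \<and>
     (\<forall>c\<in>slit_atlas A. \<forall>u\<in>dom c. \<forall>i j.
        jacobi_endo (F \<circ> param c) i j (coord c u) =
          K u * ((F u)\<^sup>2 * (if i = j then 1 else 0)
                 - F u * dy j (F \<circ> param c) (coord c u) * snd (coord c u) $ i))"

definition ricci_scalar :: "('m tpoint \<Rightarrow> real) \<Rightarrow> ('m tpoint \<Rightarrow> real) \<Rightarrow> 'm tpoint \<Rightarrow> real" where
  "ricci_scalar F K u = K u * (F u)\<^sup>2"

text \<open>\<open>h = 1/2 (Id + [J,S])\<close>, where the Froelicher-Nijenhuis bracket of the vector-valued 1-form
  \<open>J\<close> and the vector field \<open>S\<close> is \<open>[J,S] X = [J X, S] - J [X, S]\<close>.\<close>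

definition horizontal_proj :: "('m tpoint \<Rightarrow> real) \<Rightarrow> 'm tfield \<Rightarrow> 'm tfield" where
  "horizontal_proj F X = (\<lambda>u c. (1/2) *\<^sub>R
     (X u c + lie_bracket (tangent_structure X) (geodesic_spray F) u c
            - tangent_structure (lie_bracket X (geodesic_spray F)) u c))"

definition horizontal_vfield ::
    "('m, real^2) chart set \<Rightarrow> ('m tpoint \<Rightarrow> real) \<Rightarrow> 'm tfield \<Rightarrow> bool" where
  "horizontal_vfield A F H \<longleftrightarrow>
     smooth_vfield (slit_atlas A) H \<and>
     (\<exists>X. smooth_vfield (slit_atlas A) X \<and> vf_eq (slit_atlas A) H (horizontal_proj F X))"

text \<open>\<open>H\<close>, \<open>S\<close>, \<open>V = J H\<close> and the Liouville field form the Berwald frame, with main scalar \<open>\<I>\<close>,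
  Landsberg scalar \<open>\<J>\<close> and Ricci scalar \<open>\<rho>\<close>.  The condition \<open>d\<^sub>JF(H) = 0\<close> is \<open>(J H)(F) = 0\<close>.\<close>

definition berwald_frame ::
    "('m, real^2) chart set \<Rightarrow> ('m tpoint \<Rightarrow> real) \<Rightarrow> ('m tpoint \<Rightarrow> real) \<Rightarrow> 'm tfield \<Rightarrow>
     ('m tpoint \<Rightarrow> real) \<Rightarrow> ('m tpoint \<Rightarrow> real) \<Rightarrow> bool" where
  "berwald_frame A F \<rho> H \<I> \<J> \<longleftrightarrow>
     (let N = slit_atlas A; S = geodesic_spray F; V = tangent_structure H in
       horizontal_vfield A F H \<and>
       vf_eq N (lie_bracket liouville H) H \<and>
       deriv_eq N V F (\<lambda>_. 0) \<and>
       smooth_function N \<I> \<and>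
       deriv_eq N S \<I> \<J> \<and>
       vf_eq N (lie_bracket S H) (\<lambda>u c. \<rho> u *\<^sub>R V u c) \<and>
       vf_eq N (lie_bracket V S) H \<and>
       vf_eq N (lie_bracket H V) (\<lambda>u c. S u c + \<I> u *\<^sub>R H u c + \<J> u *\<^sub>R V u c))"

text \<open>\<open>F\<^sup>2\<close> is a quadratic form on each tangent space; the zero vector is included.\<close>

definition riemannian :: "('m, real^2) chart set \<Rightarrow> ('m tpoint \<Rightarrow> real) \<Rightarrow> bool" where
  "riemannian A F \<longleftrightarrow>
     (\<forall>c\<in>A. \<forall>p\<in>dom c. \<exists>a :: real^2^2. transpose a = a \<and>
        (\<forall>\<xi>. tangent_vector A p \<xi> \<longrightarrow> (F (p, \<xi>))\<^sup>2 = \<xi> c \<bullet> (a *v \<xi> c)))"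

end

theory Submission
  imports Defs
begin

text \<open>
  The proof has two independent halves: the main scalar vanishes, and a surface with vanishing main
  scalar is Riemannian.

  \<^bold>\<open>The main scalar.\<close>  On a Landsberg surface \<open>S(\<I>) = \<J> = 0\<close>, so \<open>[H, V] = S + \<I> H\<close>.
  The Jacobi identity for \<open>S\<close>, \<open>H\<close>, \<open>V\<close> then reads \<open>(\<I> \<rho> + V(\<rho>)) V = 0\<close>, and
  \<open>V\<close> has no zeros, so \<open>V(\<rho>) = - \<rho> \<I>\<close> (\<open>landsberg_ricci_derivative\<close>).  Together with
  \<open>V(\<rho>) = - \<I>\<close> this gives \<open>\<I> (\<rho> - 1) = 0\<close>.  On the open set where \<open>\<I>\<close> does not
  vanish, \<open>\<rho>\<close> is the constant \<open>1\<close>, whence \<open>\<I> = - V(\<rho>) = 0\<close>; therefore this set is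
  empty (\<open>main_scalar_eq_0\<close>).

  \<^bold>\<open>Vanishing main scalar.\<close>  Fix a point \<open>x\<close> and let \<open>\<eta>(y)\<close> be the base component of
  \<open>H\<close> at \<open>(x, y)\<close>; it is also the fibre component of \<open>V\<close>.  The base components of
  \<open>[\<C>, H] = H\<close> and of \<open>[H, V] = S\<close> say that \<open>D\<eta>\<close> maps \<open>y\<close> to \<open>\<eta>(y)\<close> and
  \<open>\<eta>(y)\<close> to \<open>- y\<close>.  Such a map \<open>\<eta>\<close> is linear, with square \<open>- id\<close>
  (\<open>complex_structure_on_punctured_plane\<close>).  Since \<open>V(F) = 0\<close>, the function \<open>F\<^sup>2\<close> is
  constant along the linear rotations generated by \<open>\<eta>\<close>, and it is homogeneous of degree two.
  The quadratic form \<open>det(y, \<eta>(y))\<close> has the same two properties, so \<open>F\<^sup>2\<close> is a constant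
  multiple of it (\<open>quadratic_if_invariant\<close>).

  Both halves are computations in the induced charts of the slit tangent bundle.  They need the
  calculus of smooth maps, including the symmetry of second derivatives behind the Jacobi identity,
  the smoothness of the spray coefficients, and the facts that a tangent vector is determined by its
  components in one chart and that these components can be prescribed.
\<close>

section \<open>Calculus of smooth maps\<close>

text \<open>\<open>frechet_derivative\<close> has an arbitrary value where a map is not differentiable,
  so equality of two maps on an open set transfers derivatives only together with differentiability.
  The induction carries both.\<close>

lemma Ck_on_cong:
  assumes "open U" "\<And>x. x \<in> U \<Longrightarrow> f x = g x" "Ck_on k U f"
  shows "Ck_on k U g"
  using assms
proof (induction k arbitrary: f g)
  case 0
  then show ?case by (simp cong: continuous_on_cong)
next
  case (Suc k)
  have "g differentiable (at x)" "frechet_derivative f (at x) = frechet_derivative g (at x)"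
    if "x \<in> U" for x
  proof -
    have f: "f differentiable (at x)" using Suc.prems that by auto
    show "frechet_derivative f (at x) = frechet_derivative g (at x)"
      using frechet_derivative_transform_within_open[OF f Suc.prems(1) that] Suc.prems(2) by auto
    show "g differentiable (at x)"
      using f has_derivative_transform_within_open[OF _ Suc.prems(1) that] Suc.prems(2)
      unfolding differentiable_def by metis
  qed
  moreover have "Ck_on k U (\<lambda>x. frechet_derivative g (at x) v)" for v
    using Suc.IH[OF Suc.prems(1), of "\<lambda>x. frechet_derivative f (at x) v"]
      Suc.prems(3) calculation(2) by auto
  ultimately show ?case by simp
qed

text \<open>The form in which all closure properties below are proved: it suffices to exhibit a
  derivative, without identifying it with \<open>frechet_derivative\<close>.\<close>

lemma Ck_on_SucI:
  assumes "open U" "\<And>x. x \<in> U \<Longrightarrow> (f has_derivative f' x) (at x)"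
    and "\<And>v. Ck_on k U (\<lambda>x. f' x v)"
  shows "Ck_on (Suc k) U f"
proof -
  have "frechet_derivative f (at x) = f' x" if "x \<in> U" for x
    using frechet_derivative_at[OF assms(2)[OF that]] by simp
  then have "Ck_on k U (\<lambda>x. frechet_derivative f (at x) v)" for v
    using Ck_on_cong[OF assms(1) _ assms(3)] by simp
  then show ?thesis using assms(2) by (auto simp: differentiable_def)
qed

lemma Ck_on_Suc_has_derivative:
  assumes "Ck_on (Suc k) U f" "x \<in> U"
  shows "(f has_derivative frechet_derivative f (at x)) (at x)"
  using assms frechet_derivative_works by auto

lemma Ck_on_Suc_imp_Ck_on: "Ck_on (Suc k) U f \<Longrightarrow> Ck_on k U f"
proof (induction k arbitrary: f)
  case 0
  then show ?case
    by (simp add: continuous_at_imp_continuous_on differentiable_imp_continuous_within)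
qed auto

lemma Ck_on_const: "Ck_on k U (\<lambda>x. c)"
  by (induction k arbitrary: c) auto

lemma Ck_on_bounded_linear:
  assumes "bounded_linear f" "open U" "Ck_on k U g"
  shows "Ck_on k U (\<lambda>x. f (g x))"
  using assms(3)
proof (induction k arbitrary: g)
  case 0
  then show ?case
    by (simp add: bounded_linear.continuous_on[OF assms(1)])
next
  case (Suc k)
  show ?case
  proof (rule Ck_on_SucI[OF assms(2)])
    show "((\<lambda>x. f (g x)) has_derivative (\<lambda>v. f (frechet_derivative g (at x) v))) (at x)"
      if "x \<in> U" for x
      by (rule bounded_linear.has_derivative[OF assms(1) Ck_on_Suc_has_derivative[OF Suc.prems that]])
    show "Ck_on k U (\<lambda>x. f (frechet_derivative g (at x) v))" for v
      using Suc.IH Suc.prems by simp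
  qed
qed

lemma Ck_on_add:
  assumes "open U" "Ck_on k U f" "Ck_on k U g"
  shows "Ck_on k U (\<lambda>x. f x + g x)"
  using assms(2,3)
proof (induction k arbitrary: f g)
  case 0
  then show ?case by (simp add: continuous_on_add)
next
  case (Suc k)
  show ?case
  proof (rule Ck_on_SucI[OF assms(1)])
    show "((\<lambda>x. f x + g x) has_derivative
        (\<lambda>v. frechet_derivative f (at x) v + frechet_derivative g (at x) v)) (at x)"
      if "x \<in> U" for x
      by (rule has_derivative_add[OF Suc.prems[THEN Ck_on_Suc_has_derivative, OF that]])
  qed (use Suc.IH Suc.prems in simp)
qed

text \<open>The Leibniz rule lowers the order of only one factor, hence the appeal to
  \<open>Ck_on_Suc_imp_Ck_on\<close> for the other one.\<close>

lemma (in bounded_bilinear) Ck_on: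
  assumes "open U" "Ck_on k U f" "Ck_on k U g"
  shows "Ck_on k U (\<lambda>x. prod (f x) (g x))"
  using assms(2,3)
proof (induction k arbitrary: f g)
  case 0
  then show ?case by (simp add: continuous_on)
next
  case (Suc k)
  show ?case
  proof (rule Ck_on_SucI[OF assms(1)])
    show "((\<lambda>x. prod (f x) (g x)) has_derivative
        (\<lambda>v. prod (f x) (frechet_derivative g (at x) v) + prod (frechet_derivative f (at x) v) (g x))) (at x)"
      if "x \<in> U" for x
      by (rule FDERIV[OF Suc.prems[THEN Ck_on_Suc_has_derivative, OF that]])
    show "Ck_on k U (\<lambda>x. prod (f x) (frechet_derivative g (at x) v) + prod (frechet_derivative f (at x) v) (g x))" for v
      using Suc.prems Suc.prems[THEN Ck_on_Suc_imp_Ck_on]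
      by (intro Ck_on_add[OF assms(1)] Suc.IH) auto
  qed
qed

lemma Ck_on_inverse:
  fixes f :: "'a::real_normed_vector \<Rightarrow> real"
  assumes "open U" "Ck_on k U f" "\<And>x. x \<in> U \<Longrightarrow> f x \<noteq> 0"
  shows "Ck_on k U (\<lambda>x. inverse (f x))"
  using assms(2)
proof (induction k)
  case 0
  then show ?case using assms(3) by (auto intro: continuous_on_inverse)
next
  case (Suc k)
  show ?case
  proof (rule Ck_on_SucI[OF assms(1)])
    show "((\<lambda>x. inverse (f x)) has_derivative
        (\<lambda>v. - (inverse (f x) * frechet_derivative f (at x) v * inverse (f x)))) (at x)"
      if "x \<in> U" for x
      by (rule Deriv.has_derivative_inverse[OF assms(3)[OF that] Ck_on_Suc_has_derivative[OF Suc.prems that]])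
    show "Ck_on k U (\<lambda>x. - (inverse (f x) * frechet_derivative f (at x) v * inverse (f x)))" for v
      using Suc.prems Suc.IH Ck_on_Suc_imp_Ck_on[OF Suc.prems]
      by (intro Ck_on_bounded_linear[OF bounded_linear_minus[OF bounded_linear_ident] assms(1)]
          bounded_bilinear.Ck_on[OF bounded_bilinear_mult assms(1)]) auto
  qed
qed

lemma smooth_on_cong:
  assumes "smooth_on U f" "open U" "\<And>x. x \<in> U \<Longrightarrow> f x = g x"
  shows "smooth_on U g"
  using assms Ck_on_cong unfolding smooth_on_def by blast

lemma smooth_on_has_derivative:
  "smooth_on U f \<Longrightarrow> x \<in> U \<Longrightarrow> (f has_derivative frechet_derivative f (at x)) (at x)"
  unfolding smooth_on_def using Ck_on_Suc_has_derivative by blast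

lemma smooth_on_differentiable: "smooth_on U f \<Longrightarrow> x \<in> U \<Longrightarrow> f differentiable (at x)"
  using smooth_on_has_derivative differentiable_def by blast

lemma smooth_on_continuous_on: "smooth_on U f \<Longrightarrow> continuous_on U f"
  unfolding smooth_on_def by (metis Ck_on.simps(1))

lemma smooth_on_frechet_derivative:
  "smooth_on U f \<Longrightarrow> smooth_on U (\<lambda>x. frechet_derivative f (at x) v)"
  unfolding smooth_on_def by (metis Ck_on.simps(2))

lemma smooth_on_const: "smooth_on U (\<lambda>x. c)"
  unfolding smooth_on_def by (simp add: Ck_on_const)

lemma smooth_on_ident: "open U \<Longrightarrow> smooth_on U (\<lambda>x. x)"
  unfolding smooth_on_def
proof
  fix k assume "open U"
  then have "Ck_on (Suc k) U (\<lambda>x. x)"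
    by (rule Ck_on_SucI[where f' = "\<lambda>x v. v"]) (auto intro: Ck_on_const)
  then show "Ck_on k U (\<lambda>x. x)" by (rule Ck_on_Suc_imp_Ck_on)
qed

lemma smooth_on_bounded_linear:
  "bounded_linear f \<Longrightarrow> open U \<Longrightarrow> smooth_on U g \<Longrightarrow> smooth_on U (\<lambda>x. f (g x))"
  unfolding smooth_on_def using Ck_on_bounded_linear by blast

lemma smooth_on_add:
  "open U \<Longrightarrow> smooth_on U f \<Longrightarrow> smooth_on U g \<Longrightarrow> smooth_on U (\<lambda>x. f x + g x)"
  unfolding smooth_on_def using Ck_on_add by blast

lemma smooth_on_uminus:
  "open U \<Longrightarrow> smooth_on U f \<Longrightarrow> smooth_on U (\<lambda>x. - f x)"
  by (rule smooth_on_bounded_linear[OF bounded_linear_minus[OF bounded_linear_ident]])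

lemma smooth_on_diff:
  "open U \<Longrightarrow> smooth_on U f \<Longrightarrow> smooth_on U g \<Longrightarrow> smooth_on U (\<lambda>x. f x - g x)"
  using smooth_on_add[of U f "\<lambda>x. - g x"] smooth_on_uminus by fastforce

lemma smooth_on_scaleR:
  "open U \<Longrightarrow> smooth_on U f \<Longrightarrow> smooth_on U g \<Longrightarrow> smooth_on U (\<lambda>x. f x *\<^sub>R g x)"
  unfolding smooth_on_def using bounded_bilinear.Ck_on[OF bounded_bilinear_scaleR] by blast

lemma smooth_on_mult:
  fixes f g :: "'a::real_normed_vector \<Rightarrow> real"
  shows "open U \<Longrightarrow> smooth_on U f \<Longrightarrow> smooth_on U g \<Longrightarrow> smooth_on U (\<lambda>x. f x * g x)"
  unfolding smooth_on_def using bounded_bilinear.Ck_on[OF bounded_bilinear_mult] by blast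

lemma smooth_on_inverse:
  fixes f :: "'a::real_normed_vector \<Rightarrow> real"
  shows "open U \<Longrightarrow> smooth_on U f \<Longrightarrow> (\<And>x. x \<in> U \<Longrightarrow> f x \<noteq> 0) \<Longrightarrow> smooth_on U (\<lambda>x. inverse (f x))"
  unfolding smooth_on_def using Ck_on_inverse by blast

lemma smooth_on_sum:
  "open U \<Longrightarrow> (\<And>i. i \<in> I \<Longrightarrow> smooth_on U (f i)) \<Longrightarrow> smooth_on U (\<lambda>x. \<Sum>i\<in>I. f i x)"
  by (induction I rule: infinite_finite_induct) (auto intro: smooth_on_const smooth_on_add)

lemma smooth_on_Pair:
  assumes "open U" "smooth_on U f" "smooth_on U g"
  shows "smooth_on U (\<lambda>x. (f x, g x))"
proof -
  have "smooth_on U (\<lambda>x. (f x, 0) + (0, g x))"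
    by (intro smooth_on_add assms smooth_on_bounded_linear[OF _ assms(1) assms(2), of "\<lambda>y. (y,0)"]
      smooth_on_bounded_linear[OF _ assms(1) assms(3), of "\<lambda>y. (0,y)"]
      bounded_linear_Pair bounded_linear_ident bounded_linear_zero)
  then show ?thesis by simp
qed

lemma smooth_on_vec_lambda:
  fixes f :: "'n::finite \<Rightarrow> 'a::real_normed_vector \<Rightarrow> real"
  assumes "open U" "\<And>i. smooth_on U (f i)"
  shows "smooth_on U (\<lambda>x. \<chi> i. f i x)"
proof -
  have "smooth_on U (\<lambda>x. \<Sum>i\<in>UNIV. f i x *\<^sub>R (axis i 1 :: real^'n))"
    by (intro smooth_on_sum smooth_on_scaleR assms smooth_on_const)
  moreover have "(\<Sum>i\<in>UNIV. f i x *\<^sub>R (axis i 1 :: real^'n)) = (\<chi> i. f i x)" for x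
    by (simp add: vec_eq_iff axis_def if_distrib[of "\<lambda>t. _ * t"] cong: if_cong)
  ultimately show ?thesis by simp
qed

lemma frechet_derivative_slice:
  assumes "f differentiable (at (x, y))"
  shows "((\<lambda>y. f (x, y)) has_derivative (\<lambda>w. frechet_derivative f (at (x, y)) (0, w))) (at y)"
  by (rule has_derivative_compose[where f = "\<lambda>y. (x, y)",
        OF _ assms[unfolded frechet_derivative_works]])
    (auto intro!: derivative_eq_intros)

lemma smooth_on_slice:
  assumes "open W" "\<And>y. y \<in> W \<Longrightarrow> (x, y) \<in> U" "smooth_on U f"
  shows "smooth_on W (\<lambda>y. f (x, y))"
proof -
  have "Ck_on k W (\<lambda>y. f (x, y))" if "Ck_on k U f" for k
    using that
  proof (induction k arbitrary: f)
    case 0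
    then show ?case using assms(2)
      by (auto intro!: continuous_on_compose2[of U f] continuous_intros)
  next
    case (Suc k)
    show ?case
    proof (rule Ck_on_SucI[OF assms(1) frechet_derivative_slice])
      show "f differentiable (at (x, y))" if "y \<in> W" for y
        using Suc.prems assms(2)[OF that] by simp
      show "Ck_on k W (\<lambda>y. frechet_derivative f (at (x, y)) (0, w))" for w
        by (rule Suc.IH) (use Suc.prems in simp)
    qed
  qed
  then show ?thesis using assms(3) by (simp add: smooth_on_def)
qed

section \<open>Symmetry of second derivatives\<close>

lemma frechet_derivative_euclidean:
  fixes f :: "'a::euclidean_space \<Rightarrow> 'b::real_normed_vector"
  assumes "f differentiable (at x)"
  shows "frechet_derivative f (at x) v = (\<Sum>b\<in>Basis. (v \<bullet> b) *\<^sub>R frechet_derivative f (at x) b)"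
proof -
  have "frechet_derivative f (at x) (\<Sum>b\<in>Basis. (v \<bullet> b) *\<^sub>R b) = 
     (\<Sum>b\<in>Basis. (v \<bullet> b) *\<^sub>R frechet_derivative f (at x) b)"
    by (simp add: linear_frechet_derivative[OF assms] linear_sum linear_cmul o_def)
  then show ?thesis by (simp add: euclidean_representation)
qed

text \<open>The chain rule for \<open>y \<mapsto> Df(y)(X(y))\<close>.  Smoothness gives information on
  \<open>Df(y)(v)\<close> only for each fixed direction \<open>v\<close>; expanding \<open>X(y)\<close> in the standard basis
  reduces the moving direction to finitely many fixed ones.\<close>

lemma has_derivative_along_field:
  fixes f :: "'a::euclidean_space \<Rightarrow> 'b::real_normed_vector" and X :: "'a \<Rightarrow> 'a"
  assumes "open U" "x \<in> U" "smooth_on U f" "(X has_derivative X') (at x)"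
  shows "((\<lambda>y. frechet_derivative f (at y) (X y)) has_derivative
     (\<lambda>w. frechet_derivative (\<lambda>y. frechet_derivative f (at y) (X x)) (at x) w
        + frechet_derivative f (at x) (X' w))) (at x)"
proof -
  let ?D = "\<lambda>b y. frechet_derivative f (at y) b"
  have d: "(?D b has_derivative frechet_derivative (?D b) (at x)) (at x)" for b
    by (rule smooth_on_has_derivative[OF smooth_on_frechet_derivative[OF assms(3)] assms(2)])
  have *: "((\<lambda>y. ?D (Y y) y) has_derivative
     (\<lambda>w. \<Sum>b\<in>Basis. (Y x \<bullet> b) *\<^sub>R frechet_derivative (?D b) (at x) w + (Y' w \<bullet> b) *\<^sub>R ?D b x)) (at x)"
    if "(Y has_derivative Y') (at x)" for Y :: "'a \<Rightarrow> 'a" and Y'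
  proof (rule has_derivative_transform_within_open[OF _ assms(1,2)])
    show "((\<lambda>y. \<Sum>b\<in>Basis. (Y y \<bullet> b) *\<^sub>R ?D b y) has_derivative
      (\<lambda>w. \<Sum>b\<in>Basis. (Y x \<bullet> b) *\<^sub>R frechet_derivative (?D b) (at x) w + (Y' w \<bullet> b) *\<^sub>R ?D b x)) (at x)"
      by (intro has_derivative_sum has_derivative_scaleR has_derivative_inner_left that d)
    show "(\<Sum>b\<in>Basis. (Y y \<bullet> b) *\<^sub>R ?D b y) = ?D (Y y) y" if "y \<in> U" for y
      by (rule frechet_derivative_euclidean[symmetric, OF smooth_on_differentiable[OF assms(3) that]])
  qed
  have "frechet_derivative (?D (X x)) (at x) = 
     (\<lambda>w. \<Sum>b\<in>Basis. (X x \<bullet> b) *\<^sub>R frechet_derivative (?D b) (at x) w)"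
    using frechet_derivative_at[OF *[OF has_derivative_const[of "X x"]]] by simp
  moreover have "?D (X' w) x = (\<Sum>b\<in>Basis. (X' w \<bullet> b) *\<^sub>R ?D b x)" for w
    by (rule frechet_derivative_euclidean[OF smooth_on_differentiable[OF assms(3,2)]])
  ultimately show ?thesis using *[OF assms(4)] by (simp add: sum.distrib)
qed

text \<open>Applying the mean value theorem first in the direction \<open>u\<close> and then in the direction
  \<open>v\<close> expresses the second difference by the mixed derivative at an intermediate point.  The
  left-hand side is symmetric in \<open>u\<close> and \<open>v\<close>.\<close>

lemma second_difference_mean_value:
  fixes f :: "'a::real_normed_vector \<Rightarrow> real"
  assumes sm: "smooth_on U f" and "t > 0"
    and seg: "\<And>a b. 0 \<le> a \<Longrightarrow> a \<le> t \<Longrightarrow> 0 \<le> b \<Longrightarrow> b \<le> t \<Longrightarrow> x + a *\<^sub>R u + b *\<^sub>R v \<in> U"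
  shows "\<exists>a b. 0 < a \<and> a < t \<and> 0 < b \<and> b < t \<and>
     f (x + t *\<^sub>R u + t *\<^sub>R v) - f (x + t *\<^sub>R u) - f (x + t *\<^sub>R v) + f x =
     t\<^sup>2 * frechet_derivative (\<lambda>y. frechet_derivative f (at y) u) (at (x + a *\<^sub>R u + b *\<^sub>R v)) v"
proof -
  let ?D = "\<lambda>y. frechet_derivative f (at y) u"
  have line: "((\<lambda>s. g (p + s *\<^sub>R w)) has_real_derivative frechet_derivative g (at (p + s *\<^sub>R w)) w) (at s)"
    if g: "smooth_on U g" and "p + s *\<^sub>R w \<in> U" for g :: "'a \<Rightarrow> real" and p w s
  proof -
    have gd: "(g has_derivative frechet_derivative g (at (p + s *\<^sub>R w))) (at (p + s *\<^sub>R w))"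
      by (rule smooth_on_has_derivative[OF that])
    have "((\<lambda>s. g (p + s *\<^sub>R w)) has_derivative
       (\<lambda>r. frechet_derivative g (at (p + s *\<^sub>R w)) (r *\<^sub>R w))) (at s)"
      by (rule has_derivative_compose[where f = "\<lambda>s. p + s *\<^sub>R w", OF _ gd])
        (auto intro!: derivative_eq_intros)
    then show ?thesis
      by (simp add: has_field_derivative_def linear_cmul[OF has_derivative_linear[OF gd]] mult_commute_abs)
  qed
  define \<phi> where "\<phi> s = f (x + t *\<^sub>R v + s *\<^sub>R u) - f (x + s *\<^sub>R u)" for s
  have "\<exists>a>0. a < t \<and> \<phi> t - \<phi> 0 = (t - 0) * (?D (x + t *\<^sub>R v + a *\<^sub>R u) - ?D (x + a *\<^sub>R u))"
    unfolding \<phi>_def using seg[of _ t] seg[of _ 0] \<open>t > 0\<close>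
    by (intro MVT2 DERIV_diff line[OF sm]) (auto simp: algebra_simps)
  then obtain a where a: "0 < a" "a < t"
    "\<phi> t - \<phi> 0 = t * (?D (x + t *\<^sub>R v + a *\<^sub>R u) - ?D (x + a *\<^sub>R u))" by auto
  have "\<exists>b>0. b < t \<and> ?D (x + a *\<^sub>R u + t *\<^sub>R v) - ?D (x + a *\<^sub>R u + 0 *\<^sub>R v) = 
     (t - 0) * frechet_derivative ?D (at (x + a *\<^sub>R u + b *\<^sub>R v)) v"
    using seg[of a] a \<open>t > 0\<close>
    by (intro MVT2 line smooth_on_frechet_derivative[OF sm]) auto
  then obtain b where "0 < b" "b < t"
    "?D (x + a *\<^sub>R u + t *\<^sub>R v) - ?D (x + a *\<^sub>R u) = t * frechet_derivative ?D (at (x + a *\<^sub>R u + b *\<^sub>R v)) v"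
    by auto
  with a show ?thesis
    by (intro exI[of _ a] exI[of _ b]) (simp add: \<phi>_def algebra_simps power2_eq_square)
qed

text \<open>Both mixed derivatives, taken at points arbitrarily close to \<open>x\<close>, equal the same second
  difference divided by \<open>t\<^sup>2\<close>; continuity forces them to agree at \<open>x\<close>.\<close>

lemma second_derivative_symmetric_real:
  fixes f :: "'a::real_normed_vector \<Rightarrow> real"
  assumes "open U" "x \<in> U" and sm: "smooth_on U f"
  shows "frechet_derivative (\<lambda>y. frechet_derivative f (at y) u) (at x) v =
    frechet_derivative (\<lambda>y. frechet_derivative f (at y) v) (at x) u"
proof (rule ccontr)
  define P where "P u v y = frechet_derivative (\<lambda>y. frechet_derivative f (at y) u) (at y) v" for u v y
  assume "\<not> ?thesis"
  then have ne: "P u v x \<noteq> P v u x" by (simp add: P_def)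
  define e where "e = \<bar>P u v x - P v u x\<bar> / 2"
  have "e > 0" using ne by (simp add: e_def)
  have "\<forall>\<^sub>F y in nhds x. dist (P u v y) (P u v x) < e" for u v
  proof -
    have "isCont (P u v) x"
      using smooth_on_continuous_on[OF smooth_on_frechet_derivative[OF smooth_on_frechet_derivative[OF sm]]]
        assms(1,2) unfolding P_def by (simp add: continuous_on_eq_continuous_at)
    then show ?thesis
      using \<open>e > 0\<close> tendstoD by (auto simp: isCont_def tendsto_at_iff_tendsto_nhds)
  qed
  then have "\<forall>\<^sub>F y in nhds x. y \<in> U \<and> dist (P u v y) (P u v x) < e \<and> dist (P v u y) (P v u x) < e"
    by (intro eventually_conj eventually_nhds_in_open[OF assms(1,2)])
  then obtain d where "d > 0" and d: "\<And>y. dist y x < d \<Longrightarrow> y \<in> U \<and>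
      dist (P u v y) (P u v x) < e \<and> dist (P v u y) (P v u x) < e"
    unfolding eventually_nhds_metric by auto
  \<comment> \<open>so small that the parallelogram spanned by \<open>t u\<close> and \<open>t v\<close> at \<open>x\<close> stays within distance \<open>d\<close>\<close>
  define t where "t = d / (2 * (norm u + norm v + 1))"
  have np: "norm u + norm v + 1 > 0" by (simp add: add_nonneg_pos)
  have "t > 0" using \<open>d > 0\<close> np by (simp add: t_def)
  have near: "dist (x + a *\<^sub>R u + b *\<^sub>R v) x < d"
    if "0 \<le> a" "a \<le> t" "0 \<le> b" "b \<le> t" for a b
  proof -
    have "dist (x + a *\<^sub>R u + b *\<^sub>R v) x = norm (a *\<^sub>R u + b *\<^sub>R v)"
      by (simp add: dist_norm)
    also have "\<dots> \<le> a * norm u + b * norm v"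
      using norm_triangle_ineq[of "a *\<^sub>R u" "b *\<^sub>R v"] that by simp
    also have "\<dots> \<le> t * norm u + t * norm v"
      using that by (intro add_mono mult_right_mono) auto
    also have "\<dots> \<le> t * (norm u + norm v + 1)"
      using \<open>t > 0\<close> by (simp add: algebra_simps)
    also have "\<dots> = d / 2"
    proof -
      have "d / (2 * n) * n = d / 2" if "n > 0" for n :: real using that by simp
      then show ?thesis using np unfolding t_def by blast
    qed
    finally show ?thesis using \<open>d > 0\<close> by simp
  qed
  obtain a b where ab: "0 < a" "a < t" "0 < b" "b < t"
    "f (x + t *\<^sub>R u + t *\<^sub>R v) - f (x + t *\<^sub>R u) - f (x + t *\<^sub>R v) + f x =
       t\<^sup>2 * P u v (x + a *\<^sub>R u + b *\<^sub>R v)"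
    using second_difference_mean_value[OF sm \<open>t > 0\<close>, of x u v] near d unfolding P_def by blast
  have near': "x + a *\<^sub>R v + b *\<^sub>R u \<in> U" if "0 \<le> a" "a \<le> t" "0 \<le> b" "b \<le> t" for a b
    using d[OF near[of b a]] that by (simp add: ac_simps)
  obtain a' b' where ab': "0 < a'" "a' < t" "0 < b'" "b' < t"
    "f (x + t *\<^sub>R v + t *\<^sub>R u) - f (x + t *\<^sub>R v) - f (x + t *\<^sub>R u) + f x =
       t\<^sup>2 * P v u (x + a' *\<^sub>R v + b' *\<^sub>R u)"
    using second_difference_mean_value[OF sm \<open>t > 0\<close> near'] unfolding P_def by blast
  have "t\<^sup>2 * P u v (x + a *\<^sub>R u + b *\<^sub>R v) = t\<^sup>2 * P v u (x + a' *\<^sub>R v + b' *\<^sub>R u)"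
    using ab(5) ab'(5) by (simp add: algebra_simps)
  then have "P u v (x + a *\<^sub>R u + b *\<^sub>R v) = P v u (x + b' *\<^sub>R u + a' *\<^sub>R v)"
    using \<open>t > 0\<close> by (simp add: algebra_simps)
  moreover have "dist (P u v (x + a *\<^sub>R u + b *\<^sub>R v)) (P u v x) < e"
    "dist (P v u (x + b' *\<^sub>R u + a' *\<^sub>R v)) (P v u x) < e"
    using d[OF near] ab ab' by auto
  ultimately show False unfolding e_def dist_real_def by (smt (verit) field_sum_of_halves)
qed

lemma second_derivative_symmetric:
  fixes f :: "'a::real_normed_vector \<Rightarrow> 'b::euclidean_space"
  assumes "open U" "x \<in> U" and sm: "smooth_on U f"
  shows "frechet_derivative (\<lambda>y. frechet_derivative f (at y) u) (at x) v =
    frechet_derivative (\<lambda>y. frechet_derivative f (at y) v) (at x) u"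
proof (rule euclidean_eqI)
  fix b :: 'b assume "b \<in> Basis"
  have smb: "smooth_on U (\<lambda>y. f y \<bullet> b)"
    by (rule smooth_on_bounded_linear[OF bounded_linear_inner_left assms(1) sm])
  have comp: "frechet_derivative (\<lambda>y. g y \<bullet> b) (at y) w = frechet_derivative g (at y) w \<bullet> b"
    if "smooth_on U g" "y \<in> U" for g :: "'a \<Rightarrow> 'b" and y w
    using frechet_derivative_at[OF has_derivative_inner_left[OF smooth_on_has_derivative[OF that]]]
    by metis
  have "frechet_derivative (\<lambda>y. frechet_derivative (\<lambda>y. f y \<bullet> b) (at y) u) (at x) v =
     frechet_derivative (\<lambda>y. frechet_derivative f (at y) u) (at x) v \<bullet> b" for u v
  proof -
    have "frechet_derivative (\<lambda>y. frechet_derivative (\<lambda>y. f y \<bullet> b) (at y) u) (at x) =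
      frechet_derivative (\<lambda>y. frechet_derivative f (at y) u \<bullet> b) (at x)"
      by (rule frechet_derivative_transform_within_open[OF
            smooth_on_differentiable[OF smooth_on_frechet_derivative[OF smb] assms(2)] assms(1,2)])
        (rule comp[OF sm])
    then show ?thesis using comp[OF smooth_on_frechet_derivative[OF sm] assms(2)] by simp
  qed
  then show "frechet_derivative (\<lambda>y. frechet_derivative f (at y) u) (at x) v \<bullet> b =
    frechet_derivative (\<lambda>y. frechet_derivative f (at y) v) (at x) u \<bullet> b"
    using second_derivative_symmetric_real[OF assms(1,2) smb] by metis
qed

section \<open>The Lie bracket of vector fields\<close>

definition field_bracket :: "('a::real_normed_vector \<Rightarrow> 'a) \<Rightarrow> ('a \<Rightarrow> 'a) \<Rightarrow> 'a \<Rightarrow> 'a" where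
  "field_bracket X Y z = frechet_derivative Y (at z) (X z) - frechet_derivative X (at z) (Y z)"

lemma field_bracket_cong:
  assumes "open U" "z \<in> U" "\<And>w. w \<in> U \<Longrightarrow> X w = X' w" "\<And>w. w \<in> U \<Longrightarrow> Y w = Y' w"
    and "X differentiable (at z)" "Y differentiable (at z)"
  shows "field_bracket X Y z = field_bracket X' Y' z"
  unfolding field_bracket_def
  using frechet_derivative_transform_within_open[OF assms(5,1,2,3)]
    frechet_derivative_transform_within_open[OF assms(6,1,2,4)] assms(2,3,4) by simp

lemma field_bracket_scaleR:
  assumes "(X has_derivative X') (at z)" "(Y has_derivative Y') (at z)" "(r has_derivative r') (at z)"
  shows "field_bracket X (\<lambda>w. r w *\<^sub>R Y w) z = r' (X z) *\<^sub>R Y z + r z *\<^sub>R field_bracket X Y z"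
proof -
  show ?thesis
    using frechet_derivative_at[symmetric, OF has_derivative_scaleR[OF assms(3,2)]] frechet_derivative_at[OF assms(1), symmetric]
      frechet_derivative_at[OF assms(2), symmetric] linear_cmul[OF has_derivative_linear[OF assms(1)]]
    by (simp add: field_bracket_def algebra_simps)
qed

lemma field_bracket_add_right:
  assumes "X differentiable (at z)" "Y differentiable (at z)" "Z differentiable (at z)"
  shows "field_bracket X (\<lambda>w. Y w + Z w) z = field_bracket X Y z + field_bracket X Z z"
  using frechet_derivative_at[OF has_derivative_add[OF assms(2)[unfolded frechet_derivative_works] 
     assms(3)[unfolded frechet_derivative_works]], symmetric]
  by (simp add: field_bracket_def linear_add[OF linear_frechet_derivative[OF assms(1)]] algebra_simps)

lemma field_bracket_self: "field_bracket X X z = 0"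
  by (simp add: field_bracket_def)

text \<open>Expanding the brackets, the terms with two first derivatives cancel identically and the
  terms with a second derivative cancel by its symmetry.\<close>

lemma jacobi_identity:
  fixes X Y Z :: "'a::euclidean_space \<Rightarrow> 'a"
  assumes "open U" "z \<in> U" "smooth_on U X" "smooth_on U Y" "smooth_on U Z"
  shows "field_bracket X (field_bracket Y Z) z + field_bracket Y (field_bracket Z X) z
    + field_bracket Z (field_bracket X Y) z = 0"
proof -
  define D2 where "D2 Q u w = frechet_derivative (\<lambda>y. frechet_derivative Q (at y) u) (at z) w"
    for Q :: "'a \<Rightarrow> 'a" and u w
  let ?D = "\<lambda>Q. frechet_derivative Q (at z)"
  have nested: "field_bracket P (field_bracket Q R) z =
     D2 R (Q z) (P z) + ?D R (?D Q (P z)) - (D2 Q (R z) (P z) + ?D Q (?D R (P z)))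
     - ?D P (?D R (Q z)) + ?D P (?D Q (R z))"
    if "smooth_on U P" "smooth_on U Q" "smooth_on U R" for P Q R :: "'a \<Rightarrow> 'a"
  proof -
    note d = smooth_on_has_derivative[OF _ assms(2)]
    have "(field_bracket Q R has_derivative (\<lambda>w. (D2 R (Q z) w + ?D R (?D Q w)) - (D2 Q (R z) w + ?D Q (?D R w)))) (at z)"
      unfolding field_bracket_def[abs_def] D2_def
      by (intro has_derivative_diff has_derivative_along_field[OF assms(1,2)] d that)
    from frechet_derivative_at[OF this] show ?thesis
      by (simp add: field_bracket_def linear_diff[OF linear_frechet_derivative[OF smooth_on_differentiable[OF that(1) assms(2)]]])
        (metis (no_types, lifting) diff_diff_eq2 diff_add_eq)
  qed
  have "D2 Q u w = D2 Q w u" if "smooth_on U Q" for Q u w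
    unfolding D2_def by (rule second_derivative_symmetric[OF assms(1,2) that])
  then have "D2 X (Y z) (Z z) = D2 X (Z z) (Y z)" "D2 Y (Z z) (X z) = D2 Y (X z) (Z z)" 
      "D2 Z (X z) (Y z) = D2 Z (Y z) (X z)"
    using assms by auto
  then show ?thesis
    unfolding nested[OF assms(3,4,5)] nested[OF assms(4,5,3)] nested[OF assms(5,3,4)]
    by simp
qed

section \<open>The main scalar of a Landsberg surface\<close>

text \<open>The Jacobi identity for \<open>S, H, V\<close>, all of whose terms are multiples of \<open>V\<close>.
  With \<open>S(m) = 0\<close> the structure
  equations give \<open>[S, [H, V]] = m [S, H] = m r V\<close>, \<open>[H, [V, S]] = [H, H] = 0\<close> and
  \<open>[V, [S, H]] = V(r) V\<close>.  In the application \<open>m\<close> is the main scalar and \<open>r\<close> the Ricci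
  scalar.\<close>

lemma landsberg_ricci_derivative:
  fixes S H V :: "'a::euclidean_space \<Rightarrow> 'a" and r m :: "'a \<Rightarrow> real"
  assumes U: "open U" "z \<in> U"
    and sm: "smooth_on U S" "smooth_on U H" "smooth_on U V" "smooth_on U r" "smooth_on U m"
    and SH: "\<And>w. w \<in> U \<Longrightarrow> field_bracket S H w = r w *\<^sub>R V w"
    and VS: "\<And>w. w \<in> U \<Longrightarrow> field_bracket V S w = H w"
    and HV: "\<And>w. w \<in> U \<Longrightarrow> field_bracket H V w = S w + m w *\<^sub>R H w"
    and Sm: "frechet_derivative m (at z) (S z) = 0"
    and V: "V z \<noteq> 0"
  shows "frechet_derivative r (at z) (V z) = - (r z * m z)"
proof -
  note d = smooth_on_differentiable[OF _ U(2)] and D = smooth_on_has_derivative[OF _ U(2)]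
  have br: "smooth_on U (field_bracket X Y)"
    if "smooth_on U X" "smooth_on U Y" for X Y :: "'a \<Rightarrow> 'a"
  proof -
    have along: "smooth_on U (\<lambda>y. frechet_derivative Y (at y) (X y))"
      if "smooth_on U X" "smooth_on U Y" for X Y :: "'a \<Rightarrow> 'a"
    proof (rule smooth_on_cong[OF _ U(1)])
      show "smooth_on U (\<lambda>y. \<Sum>b\<in>Basis. (X y \<bullet> b) *\<^sub>R frechet_derivative Y (at y) b)"
        by (intro smooth_on_sum smooth_on_scaleR smooth_on_frechet_derivative U(1) that
            smooth_on_bounded_linear[OF bounded_linear_inner_left])
    qed (use frechet_derivative_euclidean smooth_on_differentiable that in metis)
    show "smooth_on U (field_bracket X Y)"
      unfolding field_bracket_def[abs_def] by (intro smooth_on_diff U(1) along that)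
  qed
  have "field_bracket S (field_bracket H V) z = field_bracket S (\<lambda>w. S w + m w *\<^sub>R H w) z"
    by (rule field_bracket_cong[OF U]) (auto intro: HV d br sm)
  also have "\<dots> = field_bracket S S z + field_bracket S (\<lambda>w. m w *\<^sub>R H w) z"
    by (rule field_bracket_add_right) (intro d sm smooth_on_scaleR U)+
  also have "\<dots> = (m z * r z) *\<^sub>R V z"
    by (simp add: field_bracket_self field_bracket_scaleR[OF D D D] sm Sm SH U)
  finally have 1: "field_bracket S (field_bracket H V) z = (m z * r z) *\<^sub>R V z" .
  have "field_bracket H (field_bracket V S) z = field_bracket H H z"
    by (rule field_bracket_cong[OF U]) (auto intro: VS d br sm)
  then have 2: "field_bracket H (field_bracket V S) z = 0"
    by (simp add: field_bracket_self)
  have "field_bracket V (field_bracket S H) z = field_bracket V (\<lambda>w. r w *\<^sub>R V w) z"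
    by (rule field_bracket_cong[OF U]) (auto intro: SH d br sm)
  also have "\<dots> = frechet_derivative r (at z) (V z) *\<^sub>R V z"
    by (simp add: field_bracket_self field_bracket_scaleR[OF D D D] sm)
  finally have 3: "field_bracket V (field_bracket S H) z = frechet_derivative r (at z) (V z) *\<^sub>R V z" .
  have "(m z * r z + frechet_derivative r (at z) (V z)) *\<^sub>R V z = 0"
    using jacobi_identity[OF U sm(1,2,3)] 1 2 3 by (simp add: scaleR_add_left)
  then show ?thesis using V by (simp add: add_eq_0_iff mult.commute)
qed

text \<open>Comparing \<open>V(r) = - r m\<close> with \<open>V(r) = - m\<close> gives \<open>r = 1\<close> on the open set where \<open>m\<close>
  does not vanish.  There \<open>V(r) = 0\<close>, that is \<open>m = 0\<close>, so this set is empty.\<close>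

lemma main_scalar_eq_0:
  fixes S H V :: "'a::euclidean_space \<Rightarrow> 'a" and r m :: "'a \<Rightarrow> real"
  assumes U: "open U" "z \<in> U"
    and sm: "smooth_on U S" "smooth_on U H" "smooth_on U V" "smooth_on U r" "smooth_on U m"
    and SH: "\<And>w. w \<in> U \<Longrightarrow> field_bracket S H w = r w *\<^sub>R V w"
    and VS: "\<And>w. w \<in> U \<Longrightarrow> field_bracket V S w = H w"
    and HV: "\<And>w. w \<in> U \<Longrightarrow> field_bracket H V w = S w + m w *\<^sub>R H w"
    and Sm: "\<And>w. w \<in> U \<Longrightarrow> frechet_derivative m (at w) (S w) = 0"
    and V: "\<And>w. w \<in> U \<Longrightarrow> V w \<noteq> 0"
    and Vr: "\<And>w. w \<in> U \<Longrightarrow> frechet_derivative r (at w) (V w) = - m w"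
  shows "m z = 0"
proof (rule ccontr)
  assume nz: "m z \<noteq> 0"
  define W where "W = {w \<in> U. m w \<noteq> 0}"
  have W: "open W" "z \<in> W"
    using continuous_open_preimage[OF smooth_on_continuous_on[OF sm(5)] U(1), of "- {0}"] nz U(2)
    by (auto simp: W_def vimage_def Int_def)
  have "r w = 1" if "w \<in> W" for w
    using landsberg_ricci_derivative[OF U(1) _ sm SH VS HV Sm V, of w] Vr[of w] that
    by (auto simp: W_def)
  then have "frechet_derivative r (at z) = frechet_derivative (\<lambda>_. 1) (at z)"
    by (intro frechet_derivative_transform_within_open[OF smooth_on_differentiable[OF sm(4) U(2)] W]) auto
  then show False using Vr[OF U(2)] nz by simp
qed

section \<open>Functions invariant under a linear rotation\<close>

lemma plane_combination:
  fixes u v w :: "real^2"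
  assumes "u$1 * v$2 - u$2 * v$1 \<noteq> 0"
  obtains a b where "w = a *\<^sub>R u + b *\<^sub>R v"
proof
  let ?d = "u$1 * v$2 - u$2 * v$1"
  show "w = ((w$1 * v$2 - w$2 * v$1) / ?d) *\<^sub>R u + ((u$1 * w$2 - u$2 * w$1) / ?d) *\<^sub>R v"
    using assms by (simp add: vec_eq_iff forall_2 divide_simps) (simp add: algebra_simps)
qed

lemma plane_dependent:
  fixes u v :: "real^2"
  assumes "u$1 * v$2 - u$2 * v$1 = 0" "u \<noteq> 0"
  obtains c where "v = c *\<^sub>R u"
proof (cases "u$1 = 0")
  case True
  then have "u$2 \<noteq> 0" using assms(2) by (auto simp: vec_eq_iff forall_2)
  then have "v = (v$2 / u$2) *\<^sub>R u" using assms(1) True by (auto simp: vec_eq_iff forall_2)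
  then show ?thesis by (rule that)
next
  case False
  then have "v = (v$1 / u$1) *\<^sub>R u" using assms(1) by (auto simp: vec_eq_iff forall_2 field_simps)
  then show ?thesis by (rule that)
qed

lemma constant_on_punctured_plane:
  fixes f :: "real^2 \<Rightarrow> 'b::real_normed_vector"
  assumes "\<And>y. y \<noteq> 0 \<Longrightarrow> (f has_derivative (\<lambda>_. 0)) (at y)"
  shows "\<exists>k. \<forall>y. y \<noteq> 0 \<longrightarrow> f y = k"
proof -
  have "open (- {0::real^2})" "connected (- {0::real^2})"
    by (auto intro: connected_punctured_universe)
  then have "f y = f z" if "y \<noteq> 0" "z \<noteq> 0" for y z
    using has_derivative_zero_unique_connected[of "- {0}" f y z] assms that by auto
  then show ?thesis by metis
qed

text \<open>The derivative of \<open>\<eta>\<close> rotates the moving frame \<open>(y, \<eta>(y))\<close> by a quarter turn.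
  Differentiating the two hypotheses shows that the second derivative vanishes: the first gives
  \<open>D\<^sup>2\<eta>(y, w) + D\<eta>(w) = D\<eta>(w)\<close>; the second gives \<open>D\<^sup>2\<eta>(\<eta>, w) + D\<eta>(D\<eta>(w)) = - w\<close>,
  where \<open>D\<eta> \<circ> D\<eta> = - id\<close> because this holds on the frame.  Hence \<open>D\<eta>\<close> is a
  constant linear map \<open>R\<close>, and \<open>\<eta>(y) = R(y)\<close> by the first hypothesis.\<close>

lemma complex_structure_on_punctured_plane:
  fixes \<eta> :: "real^2 \<Rightarrow> real^2"
  assumes sm: "smooth_on (- {0}) \<eta>"
    and radial: "\<And>y. y \<noteq> 0 \<Longrightarrow> frechet_derivative \<eta> (at y) y = \<eta> y"
    and rot: "\<And>y. y \<noteq> 0 \<Longrightarrow> frechet_derivative \<eta> (at y) (\<eta> y) = - y"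
  shows "\<exists>R. linear R \<and> (\<forall>y. y \<noteq> 0 \<longrightarrow> \<eta> y = R y \<and> R (\<eta> y) = - y \<and>
    (\<eta> has_derivative R) (at y) \<and> y$1 * \<eta> y$2 - y$2 * \<eta> y$1 \<noteq> 0)"
proof -
  let ?U = "- {0::real^2}"
  let ?D = "\<lambda>y. frechet_derivative \<eta> (at y)"
  have U: "open ?U" by (rule open_delete[OF open_UNIV, folded Compl_eq_Diff_UNIV])
  have lin: "linear (?D y)" if "y \<noteq> 0" for y
    using linear_frechet_derivative[OF smooth_on_differentiable[OF sm]] that by auto
  have indep: "y$1 * \<eta> y$2 - y$2 * \<eta> y$1 \<noteq> 0" if y: "y \<noteq> 0" for y
  proof
    assume "y$1 * \<eta> y$2 - y$2 * \<eta> y$1 = 0"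
    \<comment> \<open>a real eigenvalue \<open>c\<close> of the rotation would satisfy \<open>c\<^sup>2 = -1\<close>\<close>
    then obtain c where c: "\<eta> y = c *\<^sub>R y" by (rule plane_dependent[OF _ y])
    have "- y = c *\<^sub>R \<eta> y"
      using rot[OF that] radial[OF that] by (simp add: c linear_cmul[OF lin[OF that]])
    then have "(c * c + 1) *\<^sub>R y = 0" using c by (simp add: scaleR_add_left)
      (metis add.commute add.right_inverse)
    moreover have "c * c + 1 > 0" by (simp add: add_nonneg_pos)
    ultimately show False using that by auto
  qed
  have const: "\<exists>k. \<forall>y. y \<noteq> 0 \<longrightarrow> ?D y v = k" for v
  proof -
    have "frechet_derivative (\<lambda>y. ?D y v) (at y) w = 0" if y: "y \<noteq> 0" for y w
    proof -
      let ?D2 = "\<lambda>v w. frechet_derivative (\<lambda>y. ?D y v) (at y) w"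
      have yU: "y \<in> ?U" using y by simp
      note d = smooth_on_has_derivative[OF sm yU]
      have along: "((\<lambda>z. ?D z (X z)) has_derivative (\<lambda>w. ?D2 (X y) w + ?D y (X' w))) (at y)"
        if "(X has_derivative X') (at y)" for X X'
        by (rule has_derivative_along_field[OF U yU sm that])
      have "((\<lambda>z. ?D z z) has_derivative ?D y) (at y)"
        by (rule has_derivative_transform_within_open[OF d U yU]) (use y radial in auto)
      then have "(\<lambda>w. ?D2 y w + ?D y w) = ?D y"
        by (rule has_derivative_unique[OF along[OF has_derivative_ident]])
      from fun_cong[OF this, of w] have r: "?D2 y w = 0" by simp
      have "((\<lambda>z. ?D z (\<eta> z)) has_derivative (\<lambda>w. - w)) (at y)"
        by (rule has_derivative_transform_within_open[OF has_derivative_minus[OF has_derivative_ident] U yU])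
          (use rot in auto)
      then have eq: "(\<lambda>w. ?D2 (\<eta> y) w + ?D y (?D y w)) = (\<lambda>w. - w)"
        by (rule has_derivative_unique[OF along[OF d]])
      obtain a b where w: "w = a *\<^sub>R y + b *\<^sub>R \<eta> y" using plane_combination indep[OF y] by blast
      have "?D y (?D y w) = - w"
        by (simp add: w linear_add[OF lin[OF y]] linear_cmul[OF lin[OF y]] radial[OF y] rot[OF y]
            linear_neg[OF lin[OF y]] linear_diff[OF lin[OF y]])
      then have e: "?D2 (\<eta> y) w = 0" using fun_cong[OF eq, of w] by simp
      obtain a b where v: "v = a *\<^sub>R y + b *\<^sub>R \<eta> y" using plane_combination indep[OF y] by blast
      have "((\<lambda>z. a *\<^sub>R ?D z y + b *\<^sub>R ?D z (\<eta> y)) has_derivative 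
         (\<lambda>w. a *\<^sub>R ?D2 y w + b *\<^sub>R ?D2 (\<eta> y) w)) (at y)"
        by (intro has_derivative_add has_derivative_scaleR_right
            smooth_on_has_derivative[OF smooth_on_frechet_derivative[OF sm] yU])
      then have "((\<lambda>z. ?D z v) has_derivative (\<lambda>w. a *\<^sub>R ?D2 y w + b *\<^sub>R ?D2 (\<eta> y) w)) (at y)"
        by (rule has_derivative_transform_within_open[OF _ U yU])
          (simp add: v linear_add[OF lin] linear_cmul[OF lin])
      then have "?D2 v = (\<lambda>w. a *\<^sub>R ?D2 y w + b *\<^sub>R ?D2 (\<eta> y) w)"
        by (rule frechet_derivative_at[symmetric])
      then show ?thesis using r e by simp
    qed
    then have "((\<lambda>y. ?D y v) has_derivative (\<lambda>_. 0)) (at y)" if "y \<noteq> 0" for y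
      using smooth_on_has_derivative[OF smooth_on_frechet_derivative[OF sm], of y v] that
      by (simp add: ext[of "frechet_derivative _ _" "\<lambda>_. 0"])
    then show ?thesis by (rule constant_on_punctured_plane)
  qed
  obtain e :: "real^2" where e: "e \<noteq> 0" using zero_neq_one by metis
  define R where "R = ?D e"
  have R: "?D y = R" if "y \<noteq> 0" for y
    using const that e unfolding R_def by (intro ext) metis
  show ?thesis
  proof (intro exI conjI allI impI)
    show "linear R" unfolding R_def by (rule lin[OF e])
    fix y :: "real^2" assume y: "y \<noteq> 0"
    show "\<eta> y = R y" "R (\<eta> y) = - y"
      using R[OF y] radial[OF y] rot[OF y] by auto
    show "(\<eta> has_derivative R) (at y)"
      using smooth_on_has_derivative[OF sm, of y] R[OF y] y by simp
    show "y$1 * \<eta> y$2 - y$2 * \<eta> y$1 \<noteq> 0" by (rule indep[OF y])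
  qed
qed

text \<open>With \<open>\<eta> = R\<close> linear, the area \<open>q(y) = det(y, R y)\<close> is a quadratic form that, like
  \<open>E\<close>, satisfies \<open>Dq(y)(y) = 2 q(y)\<close> and \<open>Dq(y)(R y) = det(R y, R y) + det(y, R R y) = 0\<close>,
  the last because \<open>R R y = - y\<close>.  So \<open>E/q\<close> is constant in both frame directions.\<close>

lemma quadratic_if_invariant:
  fixes \<eta> :: "real^2 \<Rightarrow> real^2" and E :: "real^2 \<Rightarrow> real"
  assumes sm: "smooth_on (- {0}) \<eta>" "\<And>y. y \<noteq> 0 \<Longrightarrow> (E has_derivative E' y) (at y)"
    and radial: "\<And>y. y \<noteq> 0 \<Longrightarrow> frechet_derivative \<eta> (at y) y = \<eta> y"
    and rot: "\<And>y. y \<noteq> 0 \<Longrightarrow> frechet_derivative \<eta> (at y) (\<eta> y) = - y"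
    and E: "\<And>y. y \<noteq> 0 \<Longrightarrow> E' y y = 2 * E y" "\<And>y. y \<noteq> 0 \<Longrightarrow> E' y (\<eta> y) = 0"
  shows "\<exists>a :: real^2^2. transpose a = a \<and> (\<forall>y. y \<noteq> 0 \<longrightarrow> E y = y \<bullet> (a *v y))"
proof -
  obtain R where R: "linear R" "\<And>y. y \<noteq> 0 \<Longrightarrow> \<eta> y = R y" "\<And>y. y \<noteq> 0 \<Longrightarrow> R (\<eta> y) = - y"
    "\<And>y. y \<noteq> 0 \<Longrightarrow> (\<eta> has_derivative R) (at y)"
    "\<And>y. y \<noteq> 0 \<Longrightarrow> y$1 * \<eta> y$2 - y$2 * \<eta> y$1 \<noteq> 0"
    using complex_structure_on_punctured_plane[OF sm(1) radial rot] by blast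
  define q where "q y = y$1 * \<eta> y$2 - y$2 * \<eta> y$1" for y
  have "((\<lambda>y. E y / q y) has_derivative (\<lambda>_. 0)) (at y)" if y: "y \<noteq> 0" for y
  proof -
    define q' where "q' w = (w$1 * \<eta> y$2 + y$1 * R w$2) - (w$2 * \<eta> y$1 + y$2 * R w$1)" for w
    have nth: "((\<lambda>z. f z $ i) has_derivative (\<lambda>w. f' w $ i)) (at y)"
      if "(f has_derivative f') (at y)" for f f' :: "real^2 \<Rightarrow> real^2" and i
      using bounded_linear.has_derivative[OF bounded_linear_vec_nth that] .
    have q': "(q has_derivative q') (at y)"
      unfolding q_def[abs_def] q'_def[abs_def]
      using nth[OF has_derivative_ident] nth[OF R(4)[OF y]]
      by (auto intro!: derivative_eq_intros simp: algebra_simps)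
    have qy: "q y \<noteq> 0" using R(5)[OF y] by (simp add: q_def)
    have d: "((\<lambda>y. E y / q y) has_derivative (\<lambda>w. (E' y w * q y - E y * q' w) / (q y * q y))) (at y)"
      by (rule has_derivative_divide'[OF sm(2)[OF y] q' qy])
    have lin: "linear (E' y)" by (rule has_derivative_linear[OF sm(2)[OF y]])
    have "E' y w * q y = E y * q' w" for w
    proof -
      obtain a b where w: "w = a *\<^sub>R y + b *\<^sub>R \<eta> y" using plane_combination R(5)[OF y] by blast
      have "E' y w = a * (2 * E y)"
        using E y by (simp add: w linear_add[OF lin] linear_cmul[OF lin])
      moreover have "q' y = 2 * q y" "q' (\<eta> y) = 0"
        using R(2)[OF y] R(3)[OF y] by (simp_all add: q'_def q_def algebra_simps)
      moreover have "q' w = a * q' y + b * q' (\<eta> y)"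
        by (simp add: w q'_def linear_add[OF R(1)] linear_cmul[OF R(1)] algebra_simps)
      ultimately show ?thesis by simp
    qed
    with d show ?thesis by simp
  qed
  then have "\<exists>c. \<forall>y. y \<noteq> 0 \<longrightarrow> E y / q y = c" by (rule constant_on_punctured_plane)
  then obtain c where c: "\<And>y. y \<noteq> 0 \<Longrightarrow> E y / q y = c" by blast
  define m where "m = matrix R"
  \<comment> \<open>the symmetric matrix of the quadratic form \<open>c q\<close>\<close>
  define a :: "real^2^2" where "a = c *\<^sub>R (vector [vector [m$2$1, (m$2$2 - m$1$1) / 2],
      vector [(m$2$2 - m$1$1) / 2, - m$1$2]])"
  show ?thesis
  proof (intro exI conjI allI impI)
    show "transpose a = a" by (simp add: a_def transpose_def vec_eq_iff forall_2)
    fix y :: "real^2" assume y: "y \<noteq> 0"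
    have "\<eta> y = m *v y" using R(1,2) y by (simp add: m_def)
    then have q: "q y = y$1 * (m$2$1 * y$1 + m$2$2 * y$2) - y$2 * (m$1$1 * y$1 + m$1$2 * y$2)"
      by (simp add: q_def matrix_vector_mult_def sum_2)
    have "E y = c * q y" using c[of y] y R(5)[OF y] by (auto simp: q_def)
    also have "\<dots> = y \<bullet> (a *v y)"
      by (simp add: q a_def inner_vec_def matrix_vector_mult_def sum_2 field_simps)
    finally show "E y = y \<bullet> (a *v y)" .
  qed
qed

section \<open>Smoothness of the geodesic spray\<close>

text \<open>The theorem of Cayley and Hamilton for \<open>2 \<times> 2\<close> matrices.  In this form the entries of
  the inverse are visibly smooth functions of the entries of \<open>a\<close>.\<close>

lemma matrix_inv_2:
  fixes a :: "real^2^2"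
  assumes "det a \<noteq> 0"
  shows "matrix_inv a = inverse (det a) *\<^sub>R (trace a *\<^sub>R mat 1 - a)" (is "_ = ?b")
proof -
  let ?c = "trace a *\<^sub>R mat 1 - a"
  have "?c ** a = det a *\<^sub>R mat 1" "a ** ?c = det a *\<^sub>R mat 1"
    by (simp_all add: vec_eq_iff forall_2 matrix_matrix_mult_def mat_def sum_2 trace_def det_2
        algebra_simps)
  then have l: "?b ** a = mat 1" and r: "a ** ?b = mat 1"
    using assms by (simp_all flip: scalar_matrix_assoc add: matrix_scalar_ac)
  have "b = ?b" if "b ** a = mat 1" for b
    using arg_cong[OF that, of "\<lambda>x. x ** ?b"] r
    by (simp flip: matrix_mul_assoc)
  then show ?thesis
    unfolding matrix_inv_def by (intro some_equality) (simp_all only: l r)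
qed

text \<open>Brackets with the spray can be iterated only once its coefficients are known to be smooth;
  the only operation in them that needs an argument is the inversion of the metric, which has full
  rank.\<close>

lemma smooth_on_local_spray:
  fixes L :: "(real^2) \<times> (real^2) \<Rightarrow> real"
  assumes U: "open U" and L: "smooth_on U L" and rank: "\<And>z. z \<in> U \<Longrightarrow> rank (metric L z) = 2"
  shows "smooth_on U (local_spray L)"
proof -
  have dx: "smooth_on U (dx i f)" and dy: "smooth_on U (dy i f)" if "smooth_on U f" for i f
    unfolding dx_def[abs_def] dy_def[abs_def] by (rule smooth_on_frechet_derivative[OF that])+
  have L2: "smooth_on U (\<lambda>w. (L w)\<^sup>2)"
    unfolding power2_eq_square by (rule smooth_on_mult[OF U L L])
  have g: "smooth_on U (\<lambda>z. metric L z $ i $ j)" for i j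
    using smooth_on_mult[OF U smooth_on_const[of U "1/2"] dy[OF dy[OF L2]]] by (simp add: metric_def)
  have nz: "det (metric L z) \<noteq> 0" if "z \<in> U" for z
    using rank[OF that] det_eq_0_rank[of "metric L z"] by simp
  have inv: "smooth_on U (\<lambda>z. matrix_inv (metric L z) $ i $ j)" for i j
  proof (rule smooth_on_cong[OF _ U])
    show "smooth_on U (\<lambda>z. inverse (det (metric L z)) * (trace (metric L z) * mat 1 $ i $ j - metric L z $ i $ j))"
      unfolding det_2 trace_def
      by (intro smooth_on_mult smooth_on_diff smooth_on_sum smooth_on_inverse smooth_on_const U g)
        (use nz in \<open>simp add: det_2\<close>)
  qed (simp add: matrix_inv_2[OF nz])
  have y: "smooth_on U (\<lambda>z. snd z $ k)" for k
    by (intro smooth_on_bounded_linear[OF bounded_linear_vec_nth]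
        smooth_on_bounded_linear[OF bounded_linear_snd] smooth_on_ident U)
  have G: "smooth_on U (spray_coeff L i)" for i
    unfolding spray_coeff_def[abs_def]
    by (intro smooth_on_mult smooth_on_diff smooth_on_sum smooth_on_const U inv y dx dy L2)
  show ?thesis
    unfolding local_spray_def[abs_def]
    by (intro smooth_on_Pair smooth_on_vec_lambda smooth_on_mult smooth_on_const G U
        smooth_on_bounded_linear[OF bounded_linear_snd] smooth_on_ident)
qed

section \<open>Charts of the slit tangent bundle\<close>

lemma param_coord: "inj_on (coord c) (dom c) \<Longrightarrow> p \<in> dom c \<Longrightarrow> param c (coord c p) = p"
  unfolding param_def by (rule inv_into_f_f)

lemma
  assumes "z \<in> coord c ` dom c"
  shows coord_param: "coord c (param c z) = z" and param_in_dom: "param c z \<in> dom c"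
  using assms unfolding param_def by (rule f_inv_into_f, rule inv_into_into)

lemma
  assumes "smooth_manifold M A" "c \<in> A"
  shows open_coord_dom: "open (coord c ` dom c)"
    and inj_on_coord: "inj_on (coord c) (dom c)"
    and open_coord_overlap: "d \<in> A \<Longrightarrow> open (coord c ` (dom c \<inter> dom d))"
proof -
  have c: "openin M (dom c)" "open (coord c ` dom c)"
     "homeomorphic_map (subtopology M (dom c)) (top_of_set (coord c ` dom c)) (coord c)"
    and dM: "\<And>d. d \<in> A \<Longrightarrow> openin M (dom d)"
    using assms unfolding smooth_manifold_def by blast+
  show "open (coord c ` dom c)" by fact
  have ts: "topspace (subtopology M (dom c)) = dom c"
    using openin_subset[OF c(1)] by auto
  show "inj_on (coord c) (dom c)"
    using homeomorphic_imp_injective_map[OF c(3)] by (simp only: ts)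
  assume "d \<in> A"
  then have "openin (subtopology M (dom c)) (dom c \<inter> dom d)"
    using dM unfolding openin_subtopology by blast
  then have "openin (top_of_set (coord c ` dom c)) (coord c ` (dom c \<inter> dom d))"
    using homeomorphic_imp_open_map[OF c(3)] open_map_def by blast
  then show "open (coord c ` (dom c \<inter> dom d))"
    using c(2) by (simp add: openin_open_eq)
qed

lemma transition_differentiable:
  assumes "smooth_manifold M A" "c \<in> A" "d \<in> A" "p \<in> dom c" "p \<in> dom d"
  shows "(coord d \<circ> param c) differentiable (at (coord c p))"
  using assms smooth_on_differentiable[of "coord c ` (dom c \<inter> dom d)"]
  unfolding smooth_manifold_def by blast

text \<open>The chain rule for the change of charts: it makes the transformation law of tangent vectors
  consistent, and so allows a tangent vector to be prescribed by its components in one chart.\<close>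

lemma transition_cocycle:
  assumes M: "smooth_manifold M A" and A: "c \<in> A" "d \<in> A" "e \<in> A"
    and p: "p \<in> dom c" "p \<in> dom d" "p \<in> dom e"
  shows "frechet_derivative (coord e \<circ> param c) (at (coord c p)) v =
    frechet_derivative (coord e \<circ> param d) (at (coord d p))
      (frechet_derivative (coord d \<circ> param c) (at (coord c p)) v)"
proof -
  note [simp] = param_coord[OF inj_on_coord[OF M A(1)]] param_coord[OF inj_on_coord[OF M A(2)]]
  have "frechet_derivative (coord e \<circ> param c) (at (coord c p)) =
    frechet_derivative ((coord e \<circ> param d) \<circ> (coord d \<circ> param c)) (at (coord c p))"
  proof (rule frechet_derivative_transform_within_open)
    show "open (coord c ` (dom c \<inter> dom d))" by (rule open_coord_overlap[OF M A(1,2)])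
    show "(coord e \<circ> param c) differentiable (at (coord c p))"
      by (rule transition_differentiable[OF M A(1,3) p(1,3)])
  qed (use A p in auto)
  also have "\<dots> = frechet_derivative (coord e \<circ> param d) (at ((coord d \<circ> param c) (coord c p))) \<circ>
      frechet_derivative (coord d \<circ> param c) (at (coord c p))"
    using transition_differentiable[OF M A(2,3) p(2,3)] transition_differentiable[OF M A(1,2) p(1,2)]
      A p by (intro frechet_derivative_compose) auto
  finally show ?thesis using A p by simp
qed

lemma transition_self:
  assumes M: "smooth_manifold M A" and "c \<in> A" "p \<in> dom c"
  shows "frechet_derivative (coord c \<circ> param c) (at (coord c p)) v = v"
proof -
  have "frechet_derivative (coord c \<circ> param c) (at (coord c p)) = frechet_derivative (\<lambda>z. z) (at (coord c p))"
    using assms param_coord[OF inj_on_coord[OF M assms(2)]]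
    by (intro frechet_derivative_transform_within_open[OF
          transition_differentiable[OF M assms(2,2,3,3)] open_coord_dom[OF M assms(2)]]) auto
  then show ?thesis by simp
qed

lemma tangent_vector_unique:
  fixes A :: "('p, 'e::euclidean_space) chart set"
  assumes "tangent_vector A p \<xi>" "tangent_vector A p \<xi>'" "c \<in> A" "p \<in> dom c" "\<xi> c = \<xi>' c"
  shows "\<xi> = \<xi>'"
proof
  fix d :: "('p, 'e) chart"
  let ?D = "frechet_derivative (coord d \<circ> param c) (at (coord c p))"
  show "\<xi> d = \<xi>' d"
  proof (cases "d \<in> A \<and> p \<in> dom d")
    case True
    then have "\<xi> d = ?D (\<xi> c)" "\<xi>' d = ?D (\<xi>' c)"
      using assms(1-4) unfolding tangent_vector_def by blast+
    then show ?thesis using assms(5) by simp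
  next
    case False
    then have "\<xi> d = 0" "\<xi>' d = 0" using assms(1,2) unfolding tangent_vector_def by blast+
    then show ?thesis by simp
  qed
qed

lemma tangent_vector_exists:
  assumes M: "smooth_manifold M A" and c: "c \<in> A" "p \<in> dom c"
  obtains \<xi> where "tangent_vector A p \<xi>" "\<xi> c = y"
proof
  let ?\<xi> = "\<lambda>d. if d \<in> A \<and> p \<in> dom d then frechet_derivative (coord d \<circ> param c) (at (coord c p)) y else 0"
  show "tangent_vector A p ?\<xi>"
    unfolding tangent_vector_def
  proof (intro conjI ballI impI allI)
    fix d e assume "d \<in> A" "e \<in> A" "p \<in> dom d" "p \<in> dom e"
    then show "?\<xi> e = frechet_derivative (coord e \<circ> param d) (at (coord d p)) (?\<xi> d)"
      using transition_cocycle[OF M c(1) \<open>d \<in> A\<close> \<open>e \<in> A\<close> c(2)] by simp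
  qed (simp only: if_False)
  show "?\<xi> c = y" using transition_self[OF M c] c by simp
qed

lemma tangent_vector_scaleR:
  assumes M: "smooth_manifold M A" and "tangent_vector A p \<xi>"
  shows "tangent_vector A p (\<lambda>c. t *\<^sub>R \<xi> c)"
  unfolding tangent_vector_def
proof (intro conjI ballI impI allI)
  fix c d assume a: "c \<in> A" "d \<in> A" "p \<in> dom c" "p \<in> dom d"
  then have "\<xi> d = frechet_derivative (coord d \<circ> param c) (at (coord c p)) (\<xi> c)"
    using assms(2) unfolding tangent_vector_def by blast
  then show "t *\<^sub>R \<xi> d = frechet_derivative (coord d \<circ> param c) (at (coord c p)) (t *\<^sub>R \<xi> c)"
    by (simp add: linear_cmul[OF linear_frechet_derivative[OF transition_differentiable[OF M a]]])
next
  fix c assume "\<not> (c \<in> A \<and> p \<in> dom c)"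
  then have "\<xi> c = 0" using assms(2) unfolding tangent_vector_def by blast
  then show "t *\<^sub>R \<xi> c = 0" by simp
qed

lemma tangent_vector_eq_0:
  assumes M: "smooth_manifold M A" and "tangent_vector A p \<xi>" "c \<in> A" "p \<in> dom c"
  shows "\<xi> c = 0 \<longleftrightarrow> \<xi> = (\<lambda>_. 0)"
proof
  have z: "tangent_vector A p (\<lambda>_. 0)"
    using tangent_vector_scaleR[OF M assms(2), of 0] by simp
  show "\<xi> c = 0 \<Longrightarrow> \<xi> = (\<lambda>_. 0)" 
    by (rule tangent_vector_unique[OF assms(2) z assms(3,4)])
qed simp

lemma dom_slit_chart:
  "(p, \<xi>) \<in> dom (slit_chart A c) \<longleftrightarrow> p \<in> dom c \<and> tangent_vector A p \<xi> \<and> \<xi> \<noteq> (\<lambda>_. 0)"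
  by (simp add: slit_chart_def dom_def)

lemma coord_slit_chart: "coord (slit_chart A c) (p, \<xi>) = (coord c p, \<xi> c)"
  by (simp add: slit_chart_def coord_def)

text \<open>Openness of this image is what gives derivatives of local expressions their meaning, and
  the factor \<open>- {0}\<close> is the whole punctured tangent plane, on which the fibrewise argument
  takes place.\<close>

lemma coord_slit_chart_image:
  assumes M: "smooth_manifold M A" and c: "c \<in> A"
  shows "coord (slit_chart A c) ` dom (slit_chart A c) = coord c ` dom c \<times> - {0}" (is "?l = ?r")
proof
  show "?l \<subseteq> ?r"
    using tangent_vector_eq_0[OF M _ c] by (auto simp: dom_slit_chart coord_slit_chart)
  show "?r \<subseteq> ?l"
  proof
    fix z assume "z \<in> ?r"
    then obtain p y where z: "z = (coord c p, y)" and p: "p \<in> dom c" and y: "y \<noteq> 0" by auto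
    obtain \<xi> where \<xi>: "tangent_vector A p \<xi>" "\<xi> c = y" by (rule tangent_vector_exists[OF M c p])
    with y p have "(p, \<xi>) \<in> dom (slit_chart A c)" by (auto simp: dom_slit_chart)
    then have "coord (slit_chart A c) (p, \<xi>) \<in> ?l" by (rule imageI)
    then show "z \<in> ?l" by (simp add: z coord_slit_chart \<xi>(2))
  qed
qed

lemma inj_on_coord_slit_chart:
  fixes A :: "('m, real^2) chart set"
  assumes M: "smooth_manifold M A" and c: "c \<in> A"
  shows "inj_on (coord (slit_chart A c)) (dom (slit_chart A c))"
proof (rule inj_onI)
  fix u w :: "'m tpoint"
  obtain p \<xi> q \<xi>' where uw: "u = (p, \<xi>)" "w = (q, \<xi>')" by fastforce
  assume "u \<in> dom (slit_chart A c)" "w \<in> dom (slit_chart A c)"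
    "coord (slit_chart A c) u = coord (slit_chart A c) w"
  then have a: "(p, \<xi>) \<in> dom (slit_chart A c)" "(q, \<xi>') \<in> dom (slit_chart A c)"
    "coord (slit_chart A c) (p, \<xi>) = coord (slit_chart A c) (q, \<xi>')"
    by (simp_all only: uw)
  then have "p = q" using inj_on_coord[OF M c] by (auto simp: dom_slit_chart coord_slit_chart inj_on_def)
  moreover have "\<xi> = \<xi>'"
    using a \<open>p = q\<close> by (intro tangent_vector_unique[OF _ _ c]) (auto simp: dom_slit_chart coord_slit_chart)
  ultimately show "u = w" by (simp add: uw)
qed

lemma open_slit: "open B \<Longrightarrow> open (B \<times> - {0::'a::{t1_space,zero}})"
  by (simp add: open_Times open_Compl)

section \<open>Finsler functions and Berwald frames in a chart\<close>

lemma finsler_homogeneous_in_chart: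
  assumes M: "smooth_manifold M A" and c: "c \<in> A" and F: "finsler_function A F"
    and x: "x \<in> coord c ` dom c" and "y \<noteq> 0" "t > 0"
  shows "F (param (slit_chart A c) (x, t *\<^sub>R y)) = t * F (param (slit_chart A c) (x, y))"
proof -
  let ?N = "slit_chart A c"
  obtain p where p: "p \<in> dom c" "x = coord c p" using x by auto
  obtain \<xi> where \<xi>: "tangent_vector A p \<xi>" "\<xi> c = y" by (rule tangent_vector_exists[OF M c p(1)])
  have "param ?N (x, t *\<^sub>R y) = (p, \<lambda>c. t *\<^sub>R \<xi> c)" if "t > 0" for t
  proof -
    let ?u = "(p, \<lambda>c. t *\<^sub>R \<xi> c)"
    have "t *\<^sub>R \<xi> c \<noteq> 0" using that \<open>y \<noteq> 0\<close> \<xi>(2) by simp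
    then have "?u \<in> dom ?N"
      using p(1) tangent_vector_scaleR[OF M \<xi>(1), of t] unfolding dom_slit_chart by metis
    from param_coord[OF inj_on_coord_slit_chart[OF M c] this] show ?thesis
      by (simp add: coord_slit_chart p(2) \<xi>(2))
  qed
  from this[OF \<open>t > 0\<close>] this[OF zero_less_one] show ?thesis
    using F p(1) c \<xi>(1) \<open>t > 0\<close> by (auto simp: finsler_function_def)
qed

lemma euler_homogeneous:
  fixes f :: "'a::real_normed_vector \<Rightarrow> real"
  assumes "(f has_derivative f') (at y)" "\<And>t. t > 0 \<Longrightarrow> f (t *\<^sub>R y) = t * f y"
  shows "f' y = f y"
proof -
  have "((\<lambda>t. f (t *\<^sub>R y)) has_derivative (\<lambda>s. f' (s *\<^sub>R y))) (at 1)"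
    using assms(1) by (intro has_derivative_compose[where f = "\<lambda>t. t *\<^sub>R y" and g = f])
      (auto intro!: derivative_eq_intros)
  moreover have "((\<lambda>t. f (t *\<^sub>R y)) has_derivative (\<lambda>s. s * f y)) (at (1::real))"
    by (rule has_derivative_transform_within_open[of "\<lambda>t. t * f y" _ _ _ "{0<..}"])
      (auto intro!: derivative_eq_intros simp: assms(2))
  ultimately have "(\<lambda>s. f' (s *\<^sub>R y)) = (\<lambda>s. s * f y)" by (rule has_derivative_unique)
  from fun_cong[OF this, of 1] show ?thesis by simp
qed

lemma lie_bracket_in_chart:
  assumes "z \<in> coord c ` dom c"
  shows "lie_bracket X Y (param c z) c = field_bracket (\<lambda>w. X (param c w) c) (\<lambda>w. Y (param c w) c) z"
  by (simp add: lie_bracket_def field_bracket_def coord_param[OF assms])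

text \<open>In an induced chart the components \<open>h\<close>, \<open>s\<close>, \<open>v\<close> of \<open>H\<close>, \<open>S\<close>, \<open>V\<close> are smooth
  vector fields on an open subset of \<open>\<real>\<^sup>4\<close> with the structure equations of the Berwald
  frame of a Landsberg surface, to which the coordinate calculus above applies.\<close>

lemma berwald_frame_in_chart:
  fixes A :: "('m, real^2) chart set" and c :: "('m, real^2) chart"
  defines "N \<equiv> slit_chart A c"
  defines "U \<equiv> coord c ` dom c \<times> - {0}"
  assumes M: "smooth_manifold M A" and c: "c \<in> A" and F: "finsler_function A F"
    and frame: "berwald_frame A F \<rho> H \<I> \<J>"
    and J: "\<forall>u\<in>slit_bundle A. \<J> u = 0"
  defines "L \<equiv> F \<circ> param N" and "h \<equiv> \<lambda>z. H (param N z) N"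
  defines "s \<equiv> local_spray L" and "v \<equiv> \<lambda>z. (0, fst (h z))"
  defines "m \<equiv> \<I> \<circ> param N"
  shows "open U" "smooth_on U L" "smooth_on U h" "smooth_on U m" "smooth_on U s" "smooth_on U v"
    and "\<And>z. z \<in> U \<Longrightarrow> frechet_derivative L (at z) (v z) = 0"
    and "\<And>z. z \<in> U \<Longrightarrow> frechet_derivative m (at z) (s z) = 0"
    and "\<And>z. z \<in> U \<Longrightarrow> field_bracket s h z = \<rho> (param N z) *\<^sub>R v z"
    and "\<And>z. z \<in> U \<Longrightarrow> field_bracket v s z = h z"
    and "\<And>z. z \<in> U \<Longrightarrow> field_bracket h v z = s z + m z *\<^sub>R h z"
    and "\<And>z. z \<in> U \<Longrightarrow> field_bracket (\<lambda>w. (0, snd w)) h z = h z"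
proof -
  have im: "coord N ` dom N = U" unfolding N_def U_def by (rule coord_slit_chart_image[OF M c])
  have N: "N \<in> slit_atlas A" using c by (auto simp: slit_atlas_def N_def)
  note cp = coord_param[of _ N, unfolded im] and pd = param_in_dom[of _ N, unfolded im]
  show U: "open U" unfolding U_def by (rule open_slit[OF open_coord_dom[OF M c]])
  have fr: "horizontal_vfield A F H" "vf_eq (slit_atlas A) (lie_bracket liouville H) H"
    "deriv_eq (slit_atlas A) (tangent_structure H) F (\<lambda>_. 0)" "smooth_function (slit_atlas A) \<I>"
    "deriv_eq (slit_atlas A) (geodesic_spray F) \<I> \<J>"
    "vf_eq (slit_atlas A) (lie_bracket (geodesic_spray F) H) (\<lambda>u c. \<rho> u *\<^sub>R tangent_structure H u c)"
    "vf_eq (slit_atlas A) (lie_bracket (tangent_structure H) (geodesic_spray F)) H"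
    "vf_eq (slit_atlas A) (lie_bracket H (tangent_structure H))
       (\<lambda>u c. geodesic_spray F u c + \<I> u *\<^sub>R H u c + \<J> u *\<^sub>R tangent_structure H u c)"
    using frame unfolding berwald_frame_def Let_def by blast+
  show L: "smooth_on U L"
    using F N unfolding finsler_function_def smooth_function_def L_def im[symmetric] by blast
  show h: "smooth_on U h"
    using fr(1) N unfolding horizontal_vfield_def smooth_vfield_def h_def im[symmetric] by blast
  show "smooth_on U m"
    using fr(4) N unfolding smooth_function_def m_def im[symmetric] by blast
  have "rank (metric L z) = 2" if "z \<in> U" for z
  proof -
    have "rank (metric (F \<circ> param N) (coord N (param N z))) = 2"
      using F N pd[OF that] unfolding finsler_function_def by blast
    then show ?thesis by (simp add: L_def cp[OF that])
  qed
  then show s: "smooth_on U s" unfolding s_def by (rule smooth_on_local_spray[OF U L])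
  show v: "smooth_on U v" unfolding v_def
    by (intro smooth_on_Pair U smooth_on_const smooth_on_bounded_linear[OF bounded_linear_fst] h)
  have s_eq: "geodesic_spray F (param N z) N = s z" if "z \<in> U" for z
    by (simp add: geodesic_spray_def s_def L_def cp[OF that])
  have v_eq: "tangent_structure H (param N z) N = v z" for z
    by (simp add: tangent_structure_def v_def h_def)
  have J0: "\<J> (param N z) = 0" if "z \<in> U" for z
    using J N pd[OF that] unfolding slit_bundle_def by blast
  have der: "frechet_derivative (f \<circ> param N) (at z) (X (param N z) N) = g (param N z)"
    if "deriv_eq (slit_atlas A) X f g" "z \<in> U" for X f g z
    using that(1) N pd[OF that(2)] unfolding deriv_eq_def by (metis cp that(2))
  show "frechet_derivative L (at z) (v z) = 0" if "z \<in> U" for z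
    using der[OF fr(3) that] by (simp add: v_eq L_def)
  show "frechet_derivative m (at z) (s z) = 0" if "z \<in> U" for z
    using der[OF fr(5) that] by (simp add: s_eq that m_def J0)
  have br: "field_bracket x y z = Z (param N z) N"
    if "vf_eq (slit_atlas A) (lie_bracket X Y) Z" "z \<in> U" "smooth_on U x" "smooth_on U y"
      "\<And>z. z \<in> U \<Longrightarrow> x z = X (param N z) N" "\<And>z. z \<in> U \<Longrightarrow> y z = Y (param N z) N"
    for X Y Z z x y
  proof -
    have "field_bracket x y z = lie_bracket X Y (param N z) N"
      using that by (simp add: lie_bracket_in_chart im smooth_on_differentiable field_bracket_cong[OF U])
    then show ?thesis using that(1) N pd[OF that(2)] by (simp add: vf_eq_def)
  qed
  note eqs = h_def s_eq[symmetric] v_eq[symmetric]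
  show "field_bracket s h z = \<rho> (param N z) *\<^sub>R v z" if "z \<in> U" for z
    using br[OF fr(6) that s h] by (simp add: eqs)
  show "field_bracket v s z = h z" if "z \<in> U" for z
    using br[OF fr(7) that v s] by (simp add: eqs)
  show "field_bracket h v z = s z + m z *\<^sub>R h z" if "z \<in> U" for z
    using br[OF fr(8) that h v] that by (simp add: eqs J0 m_def)
  show "field_bracket (\<lambda>w. (0, snd w)) h z = h z" if "z \<in> U" for z
  proof -
    have "smooth_on U (\<lambda>w. (0 :: real^2, snd w))"
      by (intro smooth_on_Pair smooth_on_const U smooth_on_bounded_linear[OF bounded_linear_snd] smooth_on_ident)
    from br[OF fr(2) that this h] show ?thesis by (simp add: h_def liouville_def cp)
  qed
qed

text \<open>The second field has no base component and so contributes no derivative to the base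
  component of the bracket.  For \<open>V\<close> and the Liouville field this turns the structure
  equations into equations for the derivative of \<open>H\<close> along the fibre alone.\<close>

lemma fst_bracket_vertical:
  fixes X :: "'a::real_normed_vector \<times> 'b::real_normed_vector \<Rightarrow> 'a \<times> 'b" and f :: "'a \<times> 'b \<Rightarrow> 'b"
  assumes "(X has_derivative X') (at z)" "(\<lambda>w. (0 :: 'a, f w)) differentiable (at z)"
  shows "fst (field_bracket X (\<lambda>w. (0, f w)) z) = - fst (X' (0, f z))"
proof -
  have "fst (frechet_derivative (\<lambda>w. (0 :: 'a, f w)) (at z) u) = 0" for u
  proof -
    have "((\<lambda>w. fst (0 :: 'a, f w)) has_derivative (\<lambda>u. fst (frechet_derivative (\<lambda>w. (0 :: 'a, f w)) (at z) u))) (at z)"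
      using assms(2) by (intro has_derivative_fst) (simp add: frechet_derivative_works)
    then have "((\<lambda>w. 0) has_derivative (\<lambda>u. fst (frechet_derivative (\<lambda>w. (0 :: 'a, f w)) (at z) u))) (at z)"
      by simp
    from has_derivative_unique[OF this has_derivative_const] show ?thesis by (metis)
  qed
  then show ?thesis
    using frechet_derivative_at[OF assms(1), symmetric] by (simp add: field_bracket_def)
qed

section \<open>Landsberg surfaces with vertical Ricci derivative minus the main scalar\<close>

theorem corollary5p8:
  fixes M :: "'m topology"
    and A :: "('m, real^2) chart set"
    and F K \<rho> \<I> \<J> :: "'m tpoint \<Rightarrow> real"
    and H V :: "'m tfield"
  assumes manifold: "smooth_manifold M A"
    and finsler: "finsler_function A F"
    and curvature: "flag_curvature A F K"
    and ricci: "\<rho> = ricci_scalar F K"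
    and nonflat: "\<forall>u\<in>slit_bundle A. K u \<noteq> 0"
    and frame: "berwald_frame A F \<rho> H \<I> \<J>"
    and vertical: "V = tangent_structure H"
    and landsberg: "\<forall>u\<in>slit_bundle A. \<J> u = 0"
    and main: "deriv_eq (slit_atlas A) V \<rho> (\<lambda>u. - \<I> u)"
  shows "riemannian A F"
  unfolding riemannian_def
proof (intro ballI)
  fix c p assume c: "c \<in> A" and p: "p \<in> dom c"
  define N where "N = slit_chart A c"
  define U where "U = coord c ` dom c \<times> - {0::real^2}"
  define L where "L = F \<circ> param N"
  define h where "h z = H (param N z) N" for z
  define s where "s = local_spray L"
  define v where "v z = (0::real^2, fst (h z))" for z
  define m where "m = \<I> \<circ> param N"
  define r where "r = \<rho> \<circ> param N"
  note local = berwald_frame_in_chart[OF manifold c finsler frame landsberg,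
      folded N_def U_def, folded L_def h_def m_def, folded s_def v_def]
  note U = local(1) and L = local(2) and h = local(3) and m = local(4) and s = local(5) and v = local(6)
  note L_v = local(7) and m_s = local(8) and s_h = local(9) and v_s = local(10)
    and h_v = local(11) and C_h = local(12)
  have im: "coord N ` dom N = U" unfolding N_def U_def by (rule coord_slit_chart_image[OF manifold c])
  have N: "N \<in> slit_atlas A" using c by (auto simp: slit_atlas_def N_def)
  have r: "smooth_on U r"
  proof -
    have "smooth_on U (K \<circ> param N)"
      using curvature N unfolding flag_curvature_def smooth_function_def im[symmetric] by blast
    then have "smooth_on U (\<lambda>z. (K \<circ> param N) z * (L z * L z))"
      by (intro smooth_on_mult U L)
    then show ?thesis
      by (simp add: r_def ricci ricci_scalar_def L_def comp_def power2_eq_square)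
  qed
  have r_v: "frechet_derivative r (at z) (v z) = - m z" if "z \<in> U" for z
    using main N param_in_dom[of z N] coord_param[of z N] that
    by (force simp: deriv_eq_def vertical r_def m_def v_def h_def tangent_structure_def im)
  \<comment> \<open>the base components of \<open>[H, V] = S + \<I> H\<close> and of \<open>[\<C>, H] = H\<close>\<close>
  have Dh_v: "fst (frechet_derivative h (at z) (0, fst (h z))) = - (snd z + m z *\<^sub>R fst (h z))"
    if z: "z \<in> U" for z
    using fst_bracket_vertical[OF smooth_on_has_derivative[OF h z] smooth_on_differentiable[OF v z, unfolded v_def]]
      h_v[OF z] by (simp add: v_def[abs_def] s_def local_spray_def algebra_simps)
  have Dh_C: "fst (frechet_derivative h (at z) (0, snd z)) = fst (h z)" if z: "z \<in> U" for z
  proof -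
    have "(\<lambda>w. (0 :: real^2, snd w)) differentiable (at z)"
      by (intro differentiableI[of _ "\<lambda>w. (0, snd w)"]) (auto intro!: derivative_eq_intros)
    from fst_bracket_vertical[OF smooth_on_has_derivative[OF h z] this] C_h[OF z] show ?thesis
      by (simp add: field_bracket_def algebra_simps)
  qed
  \<comment> \<open>where \<open>V\<close> vanishes, the equation \<open>Dh_v\<close> degenerates to \<open>y = 0\<close>\<close>
  have v0: "v z \<noteq> 0" if "z \<in> U" for z
  proof
    assume "v z = 0"
    then have "fst (h z) = 0" by (simp add: v_def zero_prod_def)
    then have "snd z = 0"
      using Dh_v[OF that] linear_0[OF linear_frechet_derivative[OF smooth_on_differentiable[OF h that]]]
      by (simp add: zero_prod_def)
    then show False using that by (auto simp: U_def)
  qed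
  have m0: "m z = 0" if "z \<in> U" for z
    using main_scalar_eq_0[OF U that s h v r m _ v_s h_v m_s v0 r_v] s_h
    by (simp add: r_def)
  \<comment> \<open>from here on everything takes place on the punctured tangent plane at \<open>p\<close>\<close>
  define x where "x = coord c p"
  have xU: "(x, y) \<in> U" if "y \<noteq> 0" for y using p that by (simp add: U_def x_def)
  define \<eta> where "\<eta> y = fst (h (x, y))" for y
  have \<eta>': "frechet_derivative \<eta> (at y) w = fst (frechet_derivative h (at (x, y)) (0, w))" if "y \<noteq> 0" for y w
  proof -
    have "(\<eta> has_derivative (\<lambda>w. fst (frechet_derivative h (at (x, y)) (0, w)))) (at y)"
      unfolding \<eta>_def
      by (intro has_derivative_fst frechet_derivative_slice smooth_on_differentiable[OF h] xU that)
    from frechet_derivative_at[OF this] show ?thesis by metis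
  qed
  have L': "((\<lambda>y. L (x, y)) has_derivative (\<lambda>w. frechet_derivative L (at (x, y)) (0, w))) (at y)" if "y \<noteq> 0" for y
    by (intro frechet_derivative_slice smooth_on_differentiable[OF L] xU that)
  obtain a :: "real^2^2" where a: "transpose a = a" "\<And>y. y \<noteq> 0 \<Longrightarrow> (L (x, y))\<^sup>2 = y \<bullet> (a *v y)"
  proof -
    have "\<exists>a :: real^2^2. transpose a = a \<and> (\<forall>y. y \<noteq> 0 \<longrightarrow> (L (x, y))\<^sup>2 = y \<bullet> (a *v y))"
    proof (rule quadratic_if_invariant)
      show "smooth_on (- {0}) \<eta>" unfolding \<eta>_def
        by (rule smooth_on_slice[OF _ _ smooth_on_bounded_linear[OF bounded_linear_fst U h]])
          (auto simp: xU)
      fix y :: "real^2" assume y: "y \<noteq> 0"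
      show "((\<lambda>y. (L (x, y))\<^sup>2) has_derivative (\<lambda>w. 2 * L (x, y) * frechet_derivative L (at (x, y)) (0, w))) (at y)"
        by (auto intro!: derivative_eq_intros L'[OF y])
      show "frechet_derivative \<eta> (at y) y = \<eta> y"
        using Dh_C[OF xU[OF y]] y by (simp add: \<eta>' \<eta>_def)
      show "frechet_derivative \<eta> (at y) (\<eta> y) = - y"
        using Dh_v[OF xU[OF y]] m0[OF xU[OF y]] y by (simp add: \<eta>' \<eta>_def)
      have "frechet_derivative L (at (x, y)) (0, y) = L (x, y)"
        using euler_homogeneous[OF L'[OF y]] p y
          finsler_homogeneous_in_chart[OF manifold c finsler, of x y] by (simp add: L_def N_def x_def)
      then show "2 * L (x, y) * frechet_derivative L (at (x, y)) (0, y) = 2 * (L (x, y))\<^sup>2"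
        by (simp add: power2_eq_square)
      show "2 * L (x, y) * frechet_derivative L (at (x, y)) (0, \<eta> y) = 0"
        using L_v[OF xU[OF y]] by (simp add: v_def \<eta>_def)
    qed
    then show ?thesis using that by blast
  qed
  have "(F (p, \<xi>))\<^sup>2 = \<xi> c \<bullet> (a *v \<xi> c)" if \<xi>: "tangent_vector A p \<xi>" for \<xi>
  proof (cases "\<xi> = (\<lambda>_. 0)")
    case True
    then show ?thesis using finsler p c by (auto simp: finsler_function_def)
  next
    case False
    then have "param N (x, \<xi> c) = (p, \<xi>)"
      using param_coord[OF inj_on_coord_slit_chart[OF manifold c], of "(p, \<xi>)"] p \<xi>
      by (simp add: N_def x_def dom_slit_chart coord_slit_chart)
    then show ?thesis
      using a(2)[of "\<xi> c"] tangent_vector_eq_0[OF manifold \<xi> c p] False by (simp add: L_def)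
  qed
  then show "\<exists>a :: real^2^2. transpose a = a \<and>
      (\<forall>\<xi>. tangent_vector A p \<xi> \<longrightarrow> (F (p, \<xi>))\<^sup>2 = \<xi> c \<bullet> (a *v \<xi> c))"
    using a(1) by blast
qed

end
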